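(* Let $s,\varepsilon\in(0,\infty)$, $r\in\mathbb N$ with $r>s$, $f\in\Lambda_s$, and assume the regularity $L$ of the Daubechies wavelet system satisfies $L\ge r-1$ and $L>s$. Then there exist constants $c\in(0,1)$, $m\in\mathbb N$ and $R\in(1,\infty)$ (where $m$ and $R$ may depend on $f$ and $\varepsilon$) such that for every $j\in\mathbb Z_+$, $$S_{r,j}(s,f,\varepsilon)\subset\bigcup_{i=j-m}^{j+m}\big[T^0_i(s,f,c\varepsilon)\big]_R,$$ with the convention $T^0_i(s,f,c\varepsilon):=\emptyset$ for $i<0$.
   Context: $\Delta_hf(x):=f(x+h/2)-f(x-h/2)$, $\Delta^{k+1}_h:=\Delta^k_h\Delta_h$, $\Delta_rf(x,y):=\sup_{|h|=y}|\Delta_h^rf(x)|$. $\Lambda_s$: bounded continuous $f$ with $\|f\|_{L^\infty}+\sup_{x,\,y\in(0,1]}\Delta_{\lfloor s\rfloor+1}f(x,y)/y^s<\infty$. $S_{r,j}(s,f,\varepsilon):=\{(x,y)\in\mathbb R^n\times(0,\infty):\Delta_rf(x,y)/y^s>\varepsilon,\ y\in(2^{-j-1},2^{-j}]\}$. $\mathcal D_j=\{2^{-j}(k+[0,1)^n):k\in\mathbb Z^n\}$, $\mathcal D=\bigcup_{j\ge0}\mathcal D_j$; $T(I):=I\times(\ell(I)/2,\ell(I)]$. Daubechies wavelet system of regularity $L$ ($\varphi,\psi_\ell\in C^L_c$, $\ell=1,\dots,2^n-1$, vanishing moments up to order $L$, $\{\varphi(\cdot-k)\}\cup\{2^{jn/2}\psi_\ell(2^j\cdot-k)\}$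 orthonormal basis of $L^2$), indexed by $\Omega=\{0\}\times\mathcal D_0\cup\{1,\dots,2^n-1\}\times\mathcal D$ with $\psi_{(0,k+[0,1)^n)}=\varphi(\cdot-k)$, $\psi_{(\ell,2^{-j}(k+[0,1)^n))}=2^{jn/2}\psi_\ell(2^j\cdot-k)$, $I_{(\ell,I)}=I$. $W^0_i(s,f,\varepsilon):=\{I\in\mathcal D_i:\max_{\omega\in\Omega:I_\omega=I}|\int f\psi_\omega|>\varepsilon|I|^{s/n+1/2}\}$, $T^0_i(s,f,\varepsilon):=\bigcup_{I\in W^0_i(s,f,\varepsilon)}T(I)$. Hyperbolic metric $\rho(\mathbf x,\mathbf y)=\operatorname{arccosh}(1+\frac{|\mathbf x-\mathbf y|^2}{2x_{n+1}y_{n+1}})$; $A_R:=\{\mathbf x:\inf_{\mathbf y\in A}\rho(\mathbf x,\mathbf y)<R\}$. *)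

theory Defs
  imports "HOL-Analysis.Analysis"
begin

type_synonym 'n pt = "real^'n"
type_synonym ('n) upt = "(real^('n::finite)) \<times> real"   (* points (x, y) of R^n x (0,oo) *)

definition diff1 :: "real^'n \<Rightarrow> (real^'n \<Rightarrow> real) \<Rightarrow> real^'n \<Rightarrow> real" where
  "diff1 h f x = f (x + (1/2) *\<^sub>R h) - f (x - (1/2) *\<^sub>R h)"

fun diffk :: "nat \<Rightarrow> real^'n \<Rightarrow> (real^'n \<Rightarrow> real) \<Rightarrow> real^'n \<Rightarrow> real" where
  "diffk 0 h f = f"
| "diffk (Suc k) h f = diffk k h (diff1 h f)"

definition DeltaR :: "nat \<Rightarrow> (real^'n \<Rightarrow> real) \<Rightarrow> real^'n \<Rightarrow> real \<Rightarrow> real" where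
  "DeltaR r f x y = (SUP h\<in>{h. norm h = y}. \<bar>diffk r h f x\<bar>)"

definition Lambda :: "real \<Rightarrow> (real^'n \<Rightarrow> real) set" where
  "Lambda s = {f. continuous_on UNIV f \<and> bounded (range f) \<and>
     (\<exists>C. \<forall>x. \<forall>y\<in>{0<..1}. DeltaR (nat \<lfloor>s\<rfloor> + 1) f x y / y powr s \<le> C)}"

definition S_set :: "nat \<Rightarrow> nat \<Rightarrow> real \<Rightarrow> (real^'n \<Rightarrow> real) \<Rightarrow> real \<Rightarrow> 'n upt set" where
  "S_set r j s f \<epsilon> = {(x, y). y > 0 \<and> DeltaR r f x y / y powr s > \<epsilon> \<and>
      y \<in> {2 powr (- real j - 1)<..2 powr (- real j)}}"

definition dcube :: "nat \<Rightarrow> ('n::finite \<Rightarrow> int) \<Rightarrow> (real^'n) set" where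
  "dcube j k = {x. \<forall>i. 2 powr (- real j) * of_int (k i) \<le> x $ i \<and>
                        x $ i < 2 powr (- real j) * (of_int (k i) + 1)}"

definition Tbox :: "nat \<Rightarrow> ('n::finite \<Rightarrow> int) \<Rightarrow> 'n upt set" where
  "Tbox j k = dcube j k \<times> {2 powr (- real j) / 2 <.. 2 powr (- real j)}"

fun Ck :: "nat \<Rightarrow> (real^'n \<Rightarrow> real) \<Rightarrow> bool" where
  "Ck 0 g = continuous_on UNIV g"
| "Ck (Suc k) g = (\<exists>D. (\<forall>x. (g has_derivative D x) (at x)) \<and>
                        (\<forall>i. Ck k (\<lambda>x. D x (axis i 1))))"

definition Ckc :: "nat \<Rightarrow> (real^'n \<Rightarrow> real) \<Rightarrow> bool" where
  "Ckc k g \<longleftrightarrow> Ck k g \<and> compact (closure {x. g x \<noteq> 0})"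

(* index set Omega: (l, j, k) stands for (l, 2^-j (k + [0,1)^n)) *)
definition Omega :: "(nat \<times> nat \<times> ('n::finite \<Rightarrow> int)) set" where
  "Omega = {(l, j, k). (l = 0 \<and> j = 0) \<or> (1 \<le> l \<and> l \<le> 2 ^ CARD('n) - 1)}"

definition intvec :: "('n::finite \<Rightarrow> int) \<Rightarrow> real^'n" where
  "intvec k = (\<chi> i. of_int (k i))"

definition psiw :: "(real^'n \<Rightarrow> real) \<Rightarrow> (nat \<Rightarrow> real^'n \<Rightarrow> real)
                     \<Rightarrow> nat \<times> nat \<times> ('n::finite \<Rightarrow> int) \<Rightarrow> real^'n \<Rightarrow> real" where
  "psiw \<phi> \<psi> w x = (case w of (l, j, k) \<Rightarrow>
      if l = 0 then \<phi> (x - intvec k)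
      else 2 powr (real j * real CARD('n) / 2) * \<psi> l ((2 ^ j) *\<^sub>R x - intvec k))"

definition monomial :: "('n \<Rightarrow> nat) \<Rightarrow> real^'n \<Rightarrow> real" where
  "monomial \<alpha> x = (\<Prod>i\<in>UNIV. (x $ i) ^ (\<alpha> i))"

definition wavelet_system :: "nat \<Rightarrow> (real^'n \<Rightarrow> real) \<Rightarrow> (nat \<Rightarrow> real^'n \<Rightarrow> real) \<Rightarrow> bool" where
  "wavelet_system L \<phi> \<psi> \<longleftrightarrow>
     Ckc L \<phi> \<and> (\<forall>l\<in>{1..2 ^ CARD('n) - 1}. Ckc L (\<psi> l)) \<and>
     (\<forall>l\<in>{1..2 ^ CARD('n) - 1}. \<forall>\<alpha>::'n \<Rightarrow> nat. sum \<alpha> UNIV \<le> L \<longrightarrow>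
         (LINT x|lborel. monomial \<alpha> x * \<psi> l x) = 0) \<and>
     (\<forall>w\<in>Omega. \<forall>w'\<in>Omega.
         (LINT x|lborel. psiw \<phi> \<psi> w x * psiw \<phi> \<psi> w' x) = (if w = w' then 1 else 0)) \<and>
     (\<forall>g::real^'n \<Rightarrow> real. g \<in> borel_measurable lborel \<and> integrable lborel (\<lambda>x. (g x)\<^sup>2) \<and>
         (\<forall>w\<in>Omega. (LINT x|lborel. g x * psiw \<phi> \<psi> w x) = 0)
         \<longrightarrow> (AE x in lborel. g x = 0))"

definition W0 :: "(real^'n \<Rightarrow> real) \<Rightarrow> (nat \<Rightarrow> real^'n \<Rightarrow> real) \<Rightarrow> nat \<Rightarrow> real
                   \<Rightarrow> (real^'n \<Rightarrow> real) \<Rightarrow> real \<Rightarrow> ('n::finite \<Rightarrow> int) set" where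
  "W0 \<phi> \<psi> i s f \<epsilon> = {k. \<exists>l. (l, i, k) \<in> Omega \<and>
      \<bar>LINT x|lborel. f x * psiw \<phi> \<psi> (l, i, k) x\<bar>
        > \<epsilon> * (2 powr (- real i * real CARD('n))) powr (s / real CARD('n) + 1/2)}"

definition T0 :: "(real^'n \<Rightarrow> real) \<Rightarrow> (nat \<Rightarrow> real^'n \<Rightarrow> real) \<Rightarrow> int \<Rightarrow> real
                   \<Rightarrow> (real^'n \<Rightarrow> real) \<Rightarrow> real \<Rightarrow> 'n upt set" where
  "T0 \<phi> \<psi> i s f \<epsilon> = (if i < 0 then {} else
      (\<Union>k\<in>W0 \<phi> \<psi> (nat i) s f \<epsilon>. Tbox (nat i) k))"

definition hrho :: "('n::finite) upt \<Rightarrow> 'n upt \<Rightarrow> real" where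
  "hrho p q = arcosh (1 + ((norm (fst p - fst q))\<^sup>2 + (snd p - snd q)\<^sup>2) / (2 * snd p * snd q))"

definition hnbhd :: "('n::finite) upt set \<Rightarrow> real \<Rightarrow> 'n upt set" where
  "hnbhd A R = {p. snd p > 0 \<and> (\<exists>q\<in>A. hrho p q < R)}"

end

theory Submission
  imports Defs
begin

text \<open>
  Let $f\in\Lambda_s$. The wavelet coefficients of $f$ at scale $2^{-i}$ are
  $O(2^{-i(s+n/2)})$, and $f$ is the pointwise sum of its wavelet pieces $f_i$. If
  $|h| = y \approx 2^{-j}$, then
  $|\Delta_h^r f_i(x)|$ is at most a constant times
  $c_i\, 2^{-js} \beta^{|i-j|}$ with $\beta < 1$, where $c_i$ bounds the normalised
  coefficients of the finitely many wavelets of scale $i$ seen by the difference: use the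
  smoothness of the wavelets for $i < j$ and their boundedness for $i \ge j$. If $(x, y)$ were
  hyperbolically far from all boxes with a large coefficient, $c_i$ would be at most
  $c\varepsilon$ for $|i-j| \le m$, and the sum over $i$ would be at most $\varepsilon y^s$.

  Only square integrable functions are covered by the completeness of the wavelets, so the
  expansion is first obtained for Lipschitz functions of compact support and transferred to
  bounded $f$ by duality. The decay of the coefficients comes from a recursion over scales:
  averaging $\sum_q (-1)^q \binom{N}{q} f(x + q t h)$ against a bump in $h$ replaces a test
  function with vanishing moments by smoother ones of larger scale and much smaller norm. The
  scaling function serves as the bump: its mean cannot vanish, since otherwise wide Lipschitz
  cones would have small wavelet series.
\<close>

section \<open>Finite differences\<close>

text \<open>The constant \<open>c\<close> has to be fixed before f and \<epsilon>, while
  \<open>m\<close> and \<open>R\<close> may depend on both. The geometric factors \<beta>^|i-j| have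
  a sum that depends only on s, r and the wavelets, and this sum determines \<open>c\<close>. On
  scales far from j only the decay constant of f is known, and \<open>m\<close> is taken so large
  that the geometric factor outweighs it.

  The obstacle is the decay of the coefficients. No Taylor polynomial of f can be subtracted:
  \<open>Lambda\<close> controls a single difference of order floor(s)+1, and for integer s this is
  a Zygmund class, whose members need not have s derivatives. The smoothness is therefore borrowed
  from a mollifier. Mollification at scale \<tau> multiplies the height H of a test function of
  radius \<delta> by about (\<delta>/\<tau>)^(n+N), whereas the desired bound H \<delta>^(n+s) only
  grows by the power n+s of the ratio of the radii. As N > s, each passage to a larger scale gains,
  and the recursion stops near scale 1, where boundedness of f is enough.\<close>

lemma alternating_binomial_sum_Suc:
  fixes F :: "nat \<Rightarrow> real"
  shows "(\<Sum>q\<le>Suc r. (-1)^q * real (Suc r choose q) * F q)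
       = (\<Sum>q\<le>r. (-1)^q * real (r choose q) * (F q - F (Suc q)))"
proof -
  have "(\<Sum>q\<le>Suc r. (-1)^q * real (Suc r choose q) * F q)
      = F 0 + (\<Sum>q\<le>r. (-1)^Suc q * real (Suc r choose Suc q) * F (Suc q))"
    by (subst sum.atMost_Suc_shift) simp
  also have "\<dots> = F 0 + (\<Sum>q\<le>r. (-1)^Suc q * real (r choose Suc q) * F (Suc q))
      - (\<Sum>q\<le>r. (-1)^q * real (r choose q) * F (Suc q))"
    by (simp add: algebra_simps sum.distrib sum_subtractf sum_negf)
  also have "F 0 + (\<Sum>q\<le>r. (-1)^Suc q * real (r choose Suc q) * F (Suc q))
      = (\<Sum>q\<le>Suc r. (-1)^q * real (r choose q) * F q)"
    by (subst sum.atMost_Suc_shift) simp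
  also have "\<dots> = (\<Sum>q\<le>r. (-1)^q * real (r choose q) * F q)"
    by simp
  finally show ?thesis
    by (simp add: algebra_simps sum_subtractf)
qed

text \<open>Pascal's rule, after matching the sample points of the two half steps. The explicit sum
  is used wherever the points that a difference sees have to be located.\<close>

lemma diffk_eq_sum:
  "diffk r h f x
     = (\<Sum>q\<le>r. (-1)^q * real (r choose q) * f (x + (real r / 2 - real q) *\<^sub>R h))"
proof (induction r arbitrary: f)
  case 0
  then show ?case by simp
next
  case (Suc r)
  have a: "x + (real r / 2 - real q) *\<^sub>R h + (1/2) *\<^sub>R h
      = x + (real (Suc r) / 2 - real q) *\<^sub>R h" for q
    by (simp add: vec_eq_iff algebra_simps add_divide_distrib)
  have b: "x + (real r / 2 - real q) *\<^sub>R h - (1/2) *\<^sub>R h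
      = x + (real (Suc r) / 2 - real (Suc q)) *\<^sub>R h" for q
    by (simp add: vec_eq_iff algebra_simps add_divide_distrib)
  show ?case
    unfolding diffk.simps Suc.IH diff1_def a b
    by (rule alternating_binomial_sum_Suc[symmetric])
qed

text \<open>The recursion in \<open>diffk\<close> peels off the innermost difference. Peeling off
  the outermost one makes a difference of order r+1 an increment of the r-th difference, to which
  the mean value theorem and induction apply.\<close>

lemma diffk_Suc_commute:
  "diffk (Suc r) h f x = diffk r h f (x + (1/2) *\<^sub>R h) - diffk r h f (x - (1/2) *\<^sub>R h)"
proof -
  have a: "x + (1/2) *\<^sub>R h + (real r / 2 - real q) *\<^sub>R h
      = x + (real r / 2 - real q) *\<^sub>R h + (1/2) *\<^sub>R h" for q
    by simp
  have b: "x - (1/2) *\<^sub>R h + (real r / 2 - real q) *\<^sub>R h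
      = x + (real r / 2 - real q) *\<^sub>R h - (1/2) *\<^sub>R h" for q
    by simp
  show ?thesis
    unfolding diffk.simps diffk_eq_sum a b diff1_def
    by (simp add: sum_subtractf algebra_simps)
qed

text \<open>The averaging argument needs f at the unshifted point x as its term q = 0. Central
  differences run through their sample points downwards, hence the reversed step and the shifted
  centre.\<close>

lemma forward_difference_eq_diffk:
  "(\<Sum>q\<le>N. (-1)^q * real (N choose q) * f (x + real q *\<^sub>R h))
     = diffk N (- h) f (x + (real N / 2) *\<^sub>R h)"
  unfolding diffk_eq_sum
  by (intro sum.cong refl arg_cong2[where f="(*)"] arg_cong[where f=f])
     (simp add: vec_eq_iff algebra_simps)

lemma abs_diffk_le:
  assumes "\<And>x. \<bar>f x\<bar> \<le> B"
  shows "\<bar>diffk r h f x\<bar> \<le> 2 ^ r * B"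
  using assms
proof (induction r arbitrary: f B)
  case 0
  then show ?case by simp
next
  case (Suc r)
  have "\<bar>diff1 h f x\<bar> \<le> 2 * B" for x
    unfolding diff1_def using Suc.prems[of "x + (1/2) *\<^sub>R h"] Suc.prems[of "x - (1/2) *\<^sub>R h"] by linarith
  from Suc.IH[of "diff1 h f" "2 * B", OF this] show ?case by simp
qed

lemma diffk_sum:
  "diffk r h (\<lambda>x. \<Sum>i\<in>I. c i * g i x) x = (\<Sum>i\<in>I. c i * diffk r h (g i) x)"
  unfolding diffk_eq_sum
  by (subst sum.swap[of _ I, symmetric] | simp add: sum_distrib_left mult_ac)+

lemma linear_eq_sum_axis:
  fixes D :: "real^'n \<Rightarrow> real"
  assumes "linear D"
  shows "D v = (\<Sum>i\<in>UNIV. v $ i * D (axis i 1))"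
proof -
  have "D v = D (\<Sum>i\<in>UNIV. (v $ i) *s axis i 1)"
    by (simp add: basis_expansion)
  also have "\<dots> = (\<Sum>i\<in>UNIV. D ((v $ i) *s axis i 1))"
    by (rule linear_sum[OF assms])
  also have "\<dots> = (\<Sum>i\<in>UNIV. v $ i * D (axis i 1))"
    by (simp add: linear_cmul[OF assms] scalar_mult_eq_scaleR)
  finally show ?thesis .
qed

lemma bounded_support_partial_derivative:
  fixes g :: "real^'n \<Rightarrow> real"
  assumes D: "\<And>x. (g has_derivative D x) (at x)" and b: "bounded {x. g x \<noteq> 0}"
  shows "bounded {x. D x v \<noteq> 0}"
proof (rule bounded_subset[OF bounded_closure[OF b]], rule subsetI, rule ccontr)
  fix x assume x: "x \<in> {x. D x v \<noteq> 0}" "x \<notin> closure {x. g x \<noteq> 0}"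
  have "((\<lambda>_. 0) has_derivative D x) (at x)"
    by (rule has_derivative_transform_within_open[OF D, of "- closure {x. g x \<noteq> 0}"])
       (use x(2) closure_subset[of "{x. g x \<noteq> 0}"] in auto)
  then have "D x = (\<lambda>_. 0)"
    by (rule has_derivative_unique) simp
  with x(1) show False by simp
qed

lemma continuous_bounded_support_bounded:
  fixes g :: "'a::euclidean_space \<Rightarrow> real"
  assumes "continuous_on UNIV g" and b: "bounded {x. g x \<noteq> 0}"
  shows "\<exists>C\<ge>0. \<forall>x. \<bar>g x\<bar> \<le> C"
proof -
  let ?S = "closure {x. g x \<noteq> 0}"
  have "compact (g ` ?S)"
    using assms by (intro compact_continuous_image) (auto intro: continuous_on_subset simp: compact_closure)
  then obtain C where C: "\<And>y. y \<in> g ` ?S \<Longrightarrow> norm y \<le> C"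
    using compact_imp_bounded bounded_iff by metis
  have "\<bar>g x\<bar> \<le> max C 0" for x
    using C[of "g x"] closure_subset[of "{x. g x \<noteq> 0}"] by (cases "g x = 0") auto
  then show ?thesis by (intro exI[of _ "max C 0"]) auto
qed

lemma abs_sum_coord_le:
  fixes h :: "real^'n"
  assumes "\<And>i. \<bar>a i\<bar> \<le> C i * b" 
  shows "\<bar>\<Sum>i\<in>UNIV. h $ i * a i\<bar> \<le> norm h * ((\<Sum>i\<in>UNIV. C i) * b)"
proof -
  have "\<bar>\<Sum>i\<in>UNIV. h $ i * a i\<bar> \<le> (\<Sum>i\<in>UNIV. \<bar>h $ i\<bar> * \<bar>a i\<bar>)"
    using sum_abs[of "\<lambda>i. h $ i * a i" UNIV] by (simp add: abs_mult)
  also have "\<dots> \<le> (\<Sum>i\<in>UNIV. norm h * (C i * b))"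
    by (intro sum_mono mult_mono assms component_le_norm_cart) auto
  finally show ?thesis by (simp add: sum_distrib_left sum_distrib_right)
qed

text \<open>Each derivative yields one factor \<open>norm h\<close>: the mean value theorem for t
  |-> \<Delta>^k g(x + t h) on [-1/2, 1/2] replaces one difference by the partial derivatives of g.
  Bounded support passes to them and makes the constants uniform.\<close>

lemma diffk_bound_Ck:
  fixes g :: "real^'n \<Rightarrow> real"
  assumes "Ck k g" "bounded {x. g x \<noteq> 0}"
  shows "\<exists>C\<ge>0. \<forall>h x. \<bar>diffk k h g x\<bar> \<le> C * norm h ^ k"
  using assms
proof (induction k arbitrary: g)
  case 0
  then show ?case using continuous_bounded_support_bounded[of g] by simp
next
  case (Suc k)
  from Suc.prems(1) obtain D where D: "\<And>x. (g has_derivative D x) (at x)"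
    and DC: "\<And>i. Ck k (\<lambda>x. D x (axis i 1))" by auto
  have "\<exists>C\<ge>0. \<forall>h x. \<bar>diffk k h (\<lambda>x. D x (axis i 1)) x\<bar> \<le> C * norm h ^ k" for i
    using Suc.IH[OF DC bounded_support_partial_derivative[OF D Suc.prems(2)]] .
  then obtain C where C0: "\<And>i. C i \<ge> 0"
    and C: "\<And>i h x. \<bar>diffk k h (\<lambda>x. D x (axis i 1)) x\<bar> \<le> C i * norm h ^ k" by metis
  have "\<bar>diffk (Suc k) h g x\<bar> \<le> (\<Sum>i\<in>UNIV. C i) * norm h ^ Suc k" for h x
  proof -
    define G where "G t = diffk k h g (x + t *\<^sub>R h)" for t :: real
    define G' where "G' t = (\<Sum>i\<in>UNIV. h $ i * diffk k h (\<lambda>x. D x (axis i 1)) (x + t *\<^sub>R h))" for t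
    have "(G has_real_derivative G' t) (at t)" for t
    proof -
      have 1: "((\<lambda>t. g (x + t *\<^sub>R h + c *\<^sub>R h)) has_real_derivative
          D (x + t *\<^sub>R h + c *\<^sub>R h) h) (at t)" for c
      proof -
        have "((\<lambda>t. g (x + t *\<^sub>R h + c *\<^sub>R h)) has_derivative
            (\<lambda>s. D (x + t *\<^sub>R h + c *\<^sub>R h) (s *\<^sub>R h))) (at t)"
          by (rule has_derivative_compose[where g=g and f="\<lambda>t. x + t *\<^sub>R h + c *\<^sub>R h", OF _ D])
             (auto intro!: derivative_eq_intros)
        moreover have "D z (s *\<^sub>R h) = D z h * s" for z s
          using linear_cmul[OF has_derivative_linear[OF D]] by simp
        ultimately show ?thesis by (simp add: has_field_derivative_def)
      qed
      have 2: "D z h = (\<Sum>i\<in>UNIV. h $ i * D z (axis i 1))" for z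
        by (rule linear_eq_sum_axis[OF has_derivative_linear[OF D]])
      have "((\<lambda>t. diffk k h g (x + t *\<^sub>R h)) has_real_derivative
          (\<Sum>q\<le>k. (-1)^q * real (k choose q) * D (x + t *\<^sub>R h + (real k / 2 - real q) *\<^sub>R h) h)) (at t)"
        unfolding diffk_eq_sum by (intro DERIV_sum DERIV_cmult 1)
      also have "(\<Sum>q\<le>k. (-1)^q * real (k choose q) * D (x + t *\<^sub>R h + (real k / 2 - real q) *\<^sub>R h) h)
          = diffk k h (\<lambda>x. \<Sum>i\<in>UNIV. h $ i * D x (axis i 1)) (x + t *\<^sub>R h)"
        unfolding diffk_eq_sum 2 ..
      also have "\<dots> = G' t" unfolding G'_def by (rule diffk_sum)
      finally show ?thesis unfolding G_def .
    qed
    then have "\<exists>z>-1/2. z < 1/2 \<and> G (1/2) - G (-1/2) = (1/2 - (-1/2)) * G' z"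
      by (intro MVT2) auto
    then obtain z where "G (1/2) - G (-1/2) = G' z" by auto
    moreover have "diffk (Suc k) h g x = G (1/2) - G (-1/2)"
      unfolding diffk_Suc_commute G_def by simp
    moreover have "\<bar>G' z\<bar> \<le> norm h * ((\<Sum>i\<in>UNIV. C i) * norm h ^ k)"
      unfolding G'_def by (rule abs_sum_coord_le) (rule C)
    ultimately show ?thesis by (simp add: mult_ac)
  qed
  then show ?case using C0 by (intro exI[of _ "\<Sum>i\<in>UNIV. C i"]) (auto intro: sum_nonneg)
qed

section \<open>Polynomials and Taylor approximation\<close>

text \<open>The strict degree bound makes N the number of Taylor orders and of vanishing moment
  orders alike; for d = 0 only the zero function is left, which starts the inductions without a
  special case.\<close>

inductive poly_lt :: "nat \<Rightarrow> (real^'n \<Rightarrow> real) \<Rightarrow> bool" for d where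
  zero: "poly_lt d (\<lambda>_. 0)"
| mono: "sum \<alpha> UNIV < d \<Longrightarrow> poly_lt d (monomial \<alpha>)"
| add: "poly_lt d p \<Longrightarrow> poly_lt d q \<Longrightarrow> poly_lt d (\<lambda>x. p x + q x)"
| scale: "poly_lt d p \<Longrightarrow> poly_lt d (\<lambda>x. c * p x)"

lemma poly_lt_le: "poly_lt d p \<Longrightarrow> d \<le> e \<Longrightarrow> poly_lt e p"
  by (induction rule: poly_lt.induct) (auto intro: poly_lt.intros)

lemma poly_lt_sum: "(\<And>i. i \<in> I \<Longrightarrow> poly_lt d (p i)) \<Longrightarrow> poly_lt d (\<lambda>x. \<Sum>i\<in>I. p i x)"
  by (induction I rule: infinite_finite_induct) (auto intro: poly_lt.intros)

lemma monomial_0: "monomial (\<lambda>_. 0) = (\<lambda>_. 1)"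
  by (simp add: monomial_def fun_eq_iff)

lemma poly_lt_const: "poly_lt (Suc d) (\<lambda>_. c)"
  using poly_lt.scale[OF poly_lt.mono[of "\<lambda>_. 0" "Suc d"], of c] by (simp add: monomial_0)

lemma monomial_Suc: "monomial (\<alpha>(i := Suc (\<alpha> i))) x = x $ i * monomial \<alpha> x"
  unfolding monomial_def by (simp add: prod.remove[of _ i] mult_ac)

lemma sum_fun_upd_Suc: "sum (\<alpha>(i := Suc (\<alpha> i))) (UNIV::'n::finite set) = Suc (sum \<alpha> UNIV)"
  by (simp add: sum.remove[of _ i])

lemma poly_lt_times_coord: "poly_lt d p \<Longrightarrow> poly_lt (Suc d) (\<lambda>x. x $ i * p x)"
proof (induction rule: poly_lt.induct)
  case zero
  then show ?case by (simp add: poly_lt.zero)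
next
  case (mono \<alpha>)
  then have "poly_lt (Suc d) (monomial (\<alpha>(i := Suc (\<alpha> i))))"
    by (intro poly_lt.mono) (simp only: sum_fun_upd_Suc)
  then show ?case unfolding monomial_Suc[abs_def] .
next
  case (add p q)
  from poly_lt.add[OF add.IH] show ?case by (simp add: algebra_simps)
next
  case (scale p c)
  from poly_lt.scale[OF scale.IH, of c] show ?case by (simp add: algebra_simps)
qed

text \<open>Induction on the degree: one coordinate factor is split off, and its affine image
  \<open>a $ i + c * x $ i\<close> raises the degree by at most one.\<close>

lemma monomial_affine: "poly_lt (Suc (sum \<alpha> UNIV)) (\<lambda>x. monomial \<alpha> (a + c *\<^sub>R x))"
proof (induction "sum \<alpha> UNIV" arbitrary: \<alpha>)
  case 0
  then have "\<alpha> = (\<lambda>_. 0)" by auto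
  then show ?case by (simp only: monomial_0 poly_lt_const)
next
  case (Suc m)
  then obtain i where i: "\<alpha> i \<noteq> 0" by (metis sum.not_neutral_contains_not_neutral nat.distinct(1))
  define \<beta> where "\<beta> = \<alpha>(i := \<alpha> i - 1)"
  have \<alpha>: "\<alpha> = \<beta>(i := Suc (\<beta> i))" using i by (auto simp: \<beta>_def)
  have s: "sum \<alpha> UNIV = Suc (sum \<beta> UNIV)" by (subst \<alpha>) (rule sum_fun_upd_Suc)
  have IH: "poly_lt (Suc (sum \<beta> UNIV)) (\<lambda>x. monomial \<beta> (a + c *\<^sub>R x))"
    using Suc s by simp
  have "poly_lt (Suc (sum \<alpha> UNIV)) (\<lambda>x. a $ i * monomial \<beta> (a + c *\<^sub>R x)
      + c * (x $ i * monomial \<beta> (a + c *\<^sub>R x)))"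
    unfolding s using IH
    by (intro poly_lt.add poly_lt.scale poly_lt_times_coord) (auto intro: poly_lt_le)
  then show ?case
    by (subst \<alpha>) (simp add: monomial_Suc algebra_simps del: fun_upd_apply)
qed

lemma poly_lt_affine: "poly_lt d p \<Longrightarrow> poly_lt d (\<lambda>x. p (a + c *\<^sub>R x))"
proof (induction rule: poly_lt.induct)
  case (mono \<alpha>)
  then show ?case by (intro poly_lt_le[OF monomial_affine]) simp
qed (auto intro: poly_lt.intros)

lemma monomial_scaleR: "monomial \<alpha> (t *\<^sub>R z) = t ^ (sum \<alpha> UNIV) * monomial \<alpha> z"
  unfolding monomial_def by (simp add: power_mult_distrib prod.distrib power_sum)

text \<open>Integrating along rays avoids any compatibility condition between the Taylor polynomials
  of the partial derivatives.\<close>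
lemma poly_lt_radial_antiderivative:
  "poly_lt d q \<Longrightarrow> \<exists>Q. poly_lt d Q \<and>
     (\<forall>z t. ((\<lambda>t. t * Q (t *\<^sub>R z)) has_real_derivative q (t *\<^sub>R z)) (at t))"
proof (induction rule: poly_lt.induct)
  case zero
  then show ?case by (intro exI[of _ "\<lambda>_. 0"]) (auto intro: poly_lt.zero)
next
  case (mono \<alpha>)
  \<comment> \<open>A monomial is homogeneous of degree m along the ray, so t^m integrates to
    t^(m+1)/(m+1), which is t times a multiple of the same monomial.\<close>
  define m where "m = sum \<alpha> UNIV"
  have "((\<lambda>t. t * (1 / real (Suc m) * monomial \<alpha> (t *\<^sub>R z))) has_real_derivative monomial \<alpha> (t *\<^sub>R z)) (at t)" for z t
  proof -
    have "((\<lambda>t. monomial \<alpha> z / real (Suc m) * t ^ Suc m) has_real_derivative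
        monomial \<alpha> z / real (Suc m) * (real (Suc m) * t ^ m)) (at t)"
      using DERIV_cmult[OF DERIV_pow[of "Suc m" t UNIV], of "monomial \<alpha> z / real (Suc m)"]
      by (simp del: power_Suc)
    then show ?thesis
      unfolding monomial_scaleR m_def[symmetric] by (simp add: mult_ac)
  qed
  then show ?case using mono
    by (intro exI[of _ "\<lambda>z. 1 / real (Suc m) * monomial \<alpha> z"] conjI poly_lt.scale poly_lt.mono) auto
next
  case (add p q)
  then obtain P Q where "poly_lt d P" "\<And>z t. ((\<lambda>t. t * P (t *\<^sub>R z)) has_real_derivative p (t *\<^sub>R z)) (at t)"
    "poly_lt d Q" "\<And>z t. ((\<lambda>t. t * Q (t *\<^sub>R z)) has_real_derivative q (t *\<^sub>R z)) (at t)" by blast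
  then show ?case
    by (intro exI[of _ "\<lambda>x. P x + Q x"]) (auto intro: poly_lt.add DERIV_add simp: distrib_left)
next
  case (scale p c)
  then obtain P where "poly_lt d P" "\<And>z t. ((\<lambda>t. t * P (t *\<^sub>R z)) has_real_derivative p (t *\<^sub>R z)) (at t)" by blast
  then show ?case
    by (intro exI[of _ "\<lambda>x. c * P x"])
       (auto intro: poly_lt.scale DERIV_cmult simp: mult.left_commute[of _ c])
qed

lemma poly_lt_continuous: "poly_lt d p \<Longrightarrow> continuous_on A p"
  by (induction rule: poly_lt.induct)
     (auto intro!: continuous_intros simp: monomial_def[abs_def])

text \<open>The point is that C does not depend on the base point a, since the mollifier will be
  expanded at every point. In the induction the derivative of the remainder along the ray is
  controlled by the remainders of the partial derivatives.\<close>

lemma Ck_taylor: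
  fixes g :: "real^'n \<Rightarrow> real"
  assumes "Ck N g" "bounded {x. g x \<noteq> 0}"
  shows "\<exists>C\<ge>0. \<forall>a. \<exists>p. poly_lt N p \<and> (\<forall>z. \<bar>g (a + z) - p z\<bar> \<le> C * norm z ^ N)"
  using assms
proof (induction N arbitrary: g)
  case 0
  then show ?case
    using continuous_bounded_support_bounded[of g]
    by (auto intro!: exI[of _ "\<lambda>_. 0"] intro: poly_lt.zero)
next
  case (Suc N)
  from Suc.prems(1) obtain D where D: "\<And>x. (g has_derivative D x) (at x)"
    and DC: "\<And>i. Ck N (\<lambda>x. D x (axis i 1))" by auto
  have "\<exists>C\<ge>0. \<forall>a. \<exists>p. poly_lt N p \<and> (\<forall>z. \<bar>D (a + z) (axis i 1) - p z\<bar> \<le> C * norm z ^ N)" for i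
    using Suc.IH[OF DC bounded_support_partial_derivative[OF D Suc.prems(2)]] .
  then obtain C where C0: "\<And>i. C i \<ge> 0" and
    C: "\<And>i a. \<exists>p. poly_lt N p \<and> (\<forall>z. \<bar>D (a + z) (axis i 1) - p z\<bar> \<le> C i * norm z ^ N)" by metis
  have "\<exists>p. poly_lt (Suc N) p \<and> (\<forall>z. \<bar>g (a + z) - p z\<bar> \<le> (\<Sum>i\<in>UNIV. C i) * norm z ^ Suc N)" for a
  proof -
    obtain q where q: "\<And>i. poly_lt N (q i)"
      and qb: "\<And>i z. \<bar>D (a + z) (axis i 1) - q i z\<bar> \<le> C i * norm z ^ N"
      using C by metis
    obtain Q where Q: "\<And>i. poly_lt N (Q i)"
      and Qd: "\<And>i z t. ((\<lambda>t. t * Q i (t *\<^sub>R z)) has_real_derivative q i (t *\<^sub>R z)) (at t)"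
      using poly_lt_radial_antiderivative[OF q] by metis
    \<comment> \<open>The sum is the integral over t from 0 to 1 of the approximate directional
      derivative, the sum of \<open>z $ i * q i (t *\<^sub>R z)\<close>.\<close>
    define p where "p z = g a + (\<Sum>i\<in>UNIV. z $ i * Q i z)" for z
    have "poly_lt (Suc N) p"
      unfolding p_def by (intro poly_lt.add poly_lt_const poly_lt_sum poly_lt_times_coord Q)
    moreover have "\<bar>g (a + z) - p z\<bar> \<le> (\<Sum>i\<in>UNIV. C i) * norm z ^ Suc N" for z
    proof -
      define G where "G t = g (a + t *\<^sub>R z) - (\<Sum>i\<in>UNIV. z $ i * (t * Q i (t *\<^sub>R z)))" for t
      define G' where "G' t = (\<Sum>i\<in>UNIV. z $ i * (D (a + t *\<^sub>R z) (axis i 1) - q i (t *\<^sub>R z)))" for t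
      have "(G has_real_derivative G' t) (at t)" for t
      proof -
        have "((\<lambda>t. g (a + t *\<^sub>R z)) has_derivative (\<lambda>s. D (a + t *\<^sub>R z) (s *\<^sub>R z))) (at t)"
          by (rule has_derivative_compose[where g=g and f="\<lambda>t. a + t *\<^sub>R z", OF _ D])
             (auto intro!: derivative_eq_intros)
        moreover have "D w (s *\<^sub>R z) = D w z * s" for w s
          using linear_cmul[OF has_derivative_linear[OF D]] by simp
        ultimately have "((\<lambda>t. g (a + t *\<^sub>R z)) has_real_derivative D (a + t *\<^sub>R z) z) (at t)"
          by (simp add: has_field_derivative_def)
        then have "(G has_real_derivative
            D (a + t *\<^sub>R z) z - (\<Sum>i\<in>UNIV. z $ i * q i (t *\<^sub>R z))) (at t)"
          unfolding G_def by (intro DERIV_diff DERIV_sum DERIV_cmult Qd)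
        also have "D (a + t *\<^sub>R z) z = (\<Sum>i\<in>UNIV. z $ i * D (a + t *\<^sub>R z) (axis i 1))"
          by (rule linear_eq_sum_axis[OF has_derivative_linear[OF D]])
        finally show ?thesis by (simp add: G'_def sum_subtractf right_diff_distrib)
      qed
      then have "\<exists>t>0. t < 1 \<and> G 1 - G 0 = (1 - 0) * G' t"
        by (intro MVT2) auto
      then obtain t where t: "0 < t" "t < 1" "G 1 - G 0 = G' t" by auto
      have "G 1 - G 0 = g (a + z) - p z"
        by (simp add: G_def p_def)
      moreover have "\<bar>G' t\<bar> \<le> norm z * ((\<Sum>i\<in>UNIV. C i) * norm z ^ N)"
        unfolding G'_def
      proof (rule abs_sum_coord_le)
        fix i
        have "\<bar>D (a + t *\<^sub>R z) (axis i 1) - q i (t *\<^sub>R z)\<bar> \<le> C i * norm (t *\<^sub>R z) ^ N"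
          by (rule qb)
        also have "\<dots> \<le> C i * norm z ^ N"
          using t C0 by (intro mult_left_mono power_mono) (auto simp: mult_left_le_one_le)
        finally show "\<bar>D (a + t *\<^sub>R z) (axis i 1) - q i (t *\<^sub>R z)\<bar> \<le> C i * norm z ^ N" .
      qed
      ultimately show ?thesis using t(3) by (simp add: mult_ac)
    qed
    ultimately show ?thesis by blast
  qed
  then show ?case using C0 by (intro exI[of _ "\<Sum>i\<in>UNIV. C i"]) (auto intro: sum_nonneg)
qed

section \<open>Test functions with vanishing moments\<close>

lemma integrable_bounded_support:
  fixes g :: "'a::euclidean_space \<Rightarrow> real"
  assumes "g \<in> borel_measurable borel" and "\<And>x. \<bar>g x\<bar> \<le> B"
    and "compact A" and "\<And>x. x \<notin> A \<Longrightarrow> g x = 0"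
  shows "integrable lborel g"
  by (rule integrableI_bounded_set[where A=A and B=B])
     (use assms emeasure_compact_finite[of A] in \<open>auto simp: compact_imp_closed less_top\<close>)

lemma integrable_continuous_bounded_support:
  fixes g :: "'a::euclidean_space \<Rightarrow> real"
  assumes "continuous_on UNIV g" and "\<And>x. x \<notin> cball a R \<Longrightarrow> g x = 0"
  shows "integrable lborel g"
proof -
  have "bounded {x. g x \<noteq> 0}"
    by (rule bounded_subset[OF bounded_cball[of a R]]) (use assms(2) in blast)
  then obtain C where "\<And>x. \<bar>g x\<bar> \<le> C"
    using continuous_bounded_support_bounded[OF assms(1)] by auto
  then show ?thesis
    by (intro integrable_bounded_support[of g C "cball a R"]) (auto simp: assms borel_measurable_continuous_onI)
qed

lemma abs_integral_le_cball:
  fixes g :: "'a::euclidean_space \<Rightarrow> real"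
  assumes "\<And>x. x \<in> cball a R \<Longrightarrow> \<bar>g x\<bar> \<le> B" and "\<And>x. x \<notin> cball a R \<Longrightarrow> g x = 0" and "R \<ge> 0"
  shows "\<bar>LINT x|lborel. g x\<bar> \<le> B * (unit_ball_vol DIM('a) * R ^ DIM('a))"
proof -
  have "B \<ge> 0" using assms(1)[of a] assms(3) by auto
  have i: "integrable lborel (\<lambda>x. B * indicator (cball a R) x)"
    by (intro integrable_mult_right integrable_real_indicator emeasure_lborel_cball_finite) auto
  have "\<bar>LINT x|lborel. g x\<bar> \<le> (LINT x|lborel. B * indicator (cball a R) x)"
  proof (cases "integrable lborel g")
    case True
    then show ?thesis
      by (rule Bochner_Integration.integral_abs_bound_integral[OF _ i])
         (use assms in \<open>auto simp: indicator_def\<close>)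
  next
    \<comment> \<open>A non-integrable function has integral 0 by convention.\<close>
    case False
    then show ?thesis
      using \<open>B \<ge> 0\<close> by (simp add: not_integrable_integral_eq)
  qed
  also have "\<dots> = B * measure lborel (cball a R)"
    using i by (subst Bochner_Integration.integral_mult_right_zero) (auto)
  finally show ?thesis using assms(3) by (simp add: content_cball)
qed

lemma lborel_integral_affine:
  fixes g :: "'a::euclidean_space \<Rightarrow> real"
  assumes [measurable]: "g \<in> borel_measurable borel" and "c > 0"
  shows "(LINT x|lborel. g x) = c ^ DIM('a) * (LINT x|lborel. g (t + c *\<^sub>R x))"
proof -
  have "(LINT x|lborel. g x)
      = (LINT x|density (distr lborel borel (\<lambda>x. t + c *\<^sub>R x)) (\<lambda>_. \<bar>c\<bar> ^ DIM('a)). g x)"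
    using lborel_affine[of c t] \<open>c > 0\<close> by simp
  also have "\<dots> = (LINT x|distr lborel borel (\<lambda>x. t + c *\<^sub>R x). \<bar>c\<bar> ^ DIM('a) *\<^sub>R g x)"
    by (intro integral_density) auto
  also have "\<dots> = (LINT x|lborel. \<bar>c\<bar> ^ DIM('a) *\<^sub>R g (t + c *\<^sub>R x))"
    by (intro integral_distr) auto
  finally show ?thesis using \<open>c > 0\<close> by simp
qed

lemma integral_swap_bounded_support:
  fixes G :: "'a::euclidean_space \<Rightarrow> 'b::euclidean_space \<Rightarrow> real"
  assumes "case_prod G \<in> borel_measurable borel" and "\<And>x y. \<bar>G x y\<bar> \<le> B"
    and "\<And>x y. x \<notin> cball a R \<or> y \<notin> cball b S \<Longrightarrow> G x y = 0"
  shows "(LINT y|lborel. LINT x|lborel. G x y) = (LINT x|lborel. LINT y|lborel. G x y)"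
proof -
  have i: "integrable (lborel \<Otimes>\<^sub>M lborel) (case_prod G)"
    unfolding lborel_prod
    by (rule integrable_bounded_support[of _ B "cball a R \<times> cball b S"])
       (use assms in \<open>force intro!: compact_Times split: prod.splits\<close>)+
  from lborel_pair.Fubini_integral[OF i]
  show "(LINT y|lborel. LINT x|lborel. G x y) = (LINT x|lborel. LINT y|lborel. G x y)" .
qed

text \<open>A wavelet without its L2 normalisation is of this kind. Only radius and height enter the
  estimates, never the centre, and mollification stays in the class.\<close>

definition test_fun :: "nat \<Rightarrow> real^'n \<Rightarrow> real \<Rightarrow> real \<Rightarrow> (real^'n \<Rightarrow> real) \<Rightarrow> bool" where
  "test_fun N a \<delta> H \<theta> \<longleftrightarrow> \<theta> \<in> borel_measurable borel \<and> (\<forall>x. \<bar>\<theta> x\<bar> \<le> H) \<and>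
     (\<forall>x. x \<notin> cball a \<delta> \<longrightarrow> \<theta> x = 0) \<and>
     (\<forall>p. poly_lt N p \<longrightarrow> (LINT x|lborel. p x * \<theta> x) = 0)"

lemma test_fun_mono: "test_fun N a \<delta> H \<theta> \<Longrightarrow> \<delta> \<le> \<delta>' \<Longrightarrow> test_fun N a \<delta>' H \<theta>"
  unfolding test_fun_def by force

section \<open>Mollified test functions and the recursion over scales\<close>

locale mollifier =
  fixes \<eta> :: "real^'n \<Rightarrow> real" and K T X :: real and N :: nat
  assumes cont: "continuous_on UNIV \<eta>" and supp: "\<And>z. norm z > K \<Longrightarrow> \<eta> z = 0"
    and K: "K > 0" and X: "\<And>z. \<bar>\<eta> z\<bar> \<le> X" and int_one: "(LINT z|lborel. \<eta> z) = 1"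
    and taylor: "\<And>a. \<exists>p. poly_lt N p \<and> (\<forall>z. \<bar>\<eta> (a + z) - p z\<bar> \<le> T * norm z ^ N)"
begin

lemma meas[measurable]: "\<eta> \<in> borel_measurable borel"
  using cont by (rule borel_measurable_continuous_onI)

text \<open>Convolution with \<tau>^(-n) \<eta>(./\<tau>). It is the adjoint of the average of g(x +
  \<tau> h) with weight \<eta>(h), which is how averages of f become integrals of f against new test
  functions.\<close>

definition mollify :: "real \<Rightarrow> (real^'n \<Rightarrow> real) \<Rightarrow> real^'n \<Rightarrow> real" where
  "mollify \<tau> \<theta> z = (1/\<tau>) ^ CARD('n) * (LINT x|lborel. \<eta> ((1/\<tau>) *\<^sub>R (z - x)) * \<theta> x)"

lemma T_nonneg: "T \<ge> 0"
proof -
  obtain p where p: "\<And>z. \<bar>\<eta> (0 + z) - p z\<bar> \<le> T * norm z ^ N" using taylor by blast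
  obtain z :: "real^'n" where "norm z = 1" using vector_choose_size[of 1] by auto
  with p[of z] show ?thesis by simp
qed

lemma X_nonneg: "X \<ge> 0" using X[of 0] by linarith

text \<open>Two applications of Fubini. The first equation transfers the average from g to \<theta>;
  the second exposes integrals of translates of g against \<theta>, which vanish for polynomials, so
  that mollification preserves vanishing moments.\<close>

lemma mollify_integral:
  assumes \<theta>: "test_fun N a \<delta> H \<theta>" and g: "continuous_on UNIV g" and \<tau>: "\<tau> > 0"
  shows "(LINT z|lborel. g z * mollify \<tau> \<theta> z)
       = (LINT x|lborel. \<theta> x * (LINT h|lborel. \<eta> h * g (x + \<tau> *\<^sub>R h)))"
    and "(LINT x|lborel. \<theta> x * (LINT h|lborel. \<eta> h * g (x + \<tau> *\<^sub>R h)))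
       = (LINT h|lborel. \<eta> h * (LINT x|lborel. g (x + \<tau> *\<^sub>R h) * \<theta> x))"
    and "mollify \<tau> \<theta> \<in> borel_measurable borel"
proof -
  note \<theta>' = \<theta>[unfolded test_fun_def]
  have [measurable]: "\<theta> \<in> borel_measurable borel" "g \<in> borel_measurable borel"
    using \<theta>' borel_measurable_continuous_onI[OF g] by auto
  have H: "H \<ge> 0" using \<theta>' abs_ge_zero order_trans by blast
  \<comment> \<open>The function g may be an unbounded polynomial, so a bound is taken on the ball
    that contains the supports involved.\<close>
  obtain B where B: "\<And>z. z \<in> cball a (\<delta> + K * \<tau>) \<Longrightarrow> \<bar>g z\<bar> \<le> B" and B0: "B \<ge> 0"
  proof -
    have "compact (g ` cball a (\<delta> + K * \<tau>))"
      by (intro compact_continuous_image continuous_on_subset[OF g]) auto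
    then obtain C where "\<And>y. y \<in> g ` cball a (\<delta> + K * \<tau>) \<Longrightarrow> norm y \<le> C"
      using compact_imp_bounded bounded_iff by metis
    then show thesis by (intro that[of "max C 0"]) (auto intro: max.coboundedI1)
  qed
  have supp': "\<eta> ((1/\<tau>) *\<^sub>R (z - x)) * \<theta> x = 0" if "z \<notin> cball a (\<delta> + K * \<tau>) \<or> x \<notin> cball a \<delta>" for z x
  proof (cases "x \<in> cball a \<delta>")
    case True
    then have "dist a z > \<delta> + K * \<tau>" "dist a x \<le> \<delta>" using that by auto
    then have "norm (z - x) > K * \<tau>"
      using dist_triangle[of a z x] by (simp add: dist_norm norm_minus_commute)
    then have "norm ((1/\<tau>) *\<^sub>R (z - x)) > K" using \<tau> unfolding norm_scaleR by (simp add: pos_less_divide_eq)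
    then show ?thesis by (simp add: supp)
  qed (use \<theta>' in auto)
  define G where "G z x = g z * ((1/\<tau>) ^ CARD('n) * (\<eta> ((1/\<tau>) *\<^sub>R (z - x)) * \<theta> x))" for z x
  have Gm: "case_prod G \<in> borel_measurable borel"
    unfolding G_def borel_prod[symmetric] by measurable
  have Gb: "\<bar>G z x\<bar> \<le> B * ((1/\<tau>) ^ CARD('n) * (X * H))" for z x
  proof (cases "z \<in> cball a (\<delta> + K * \<tau>)")
    case True
    then show ?thesis unfolding G_def abs_mult using \<theta>' X B B0 \<tau> H X_nonneg
      by (intro mult_mono) auto
  next
    case False
    then have "G z x = 0" using supp'[of z x] unfolding G_def by simp
    then show ?thesis using B0 \<tau> X_nonneg H by simp
  qed
  have Gs: "G z x = 0" if "z \<notin> cball a (\<delta> + K * \<tau>) \<or> x \<notin> cball a \<delta>" for z x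
    using supp'[OF that] by (simp add: G_def)
  have "(LINT z|lborel. g z * mollify \<tau> \<theta> z) = (LINT z|lborel. LINT x|lborel. G z x)"
    unfolding mollify_def G_def by simp
  also have "\<dots> = (LINT x|lborel. LINT z|lborel. G z x)"
    using integral_swap_bounded_support[OF Gm Gb, of a "\<delta> + K * \<tau>" a \<delta>] Gs by simp
  also have "\<dots> = (LINT x|lborel. \<theta> x * (LINT h|lborel. \<eta> h * g (x + \<tau> *\<^sub>R h)))"
  proof (rule Bochner_Integration.integral_cong[OF refl])
    fix x
    have "(LINT z|lborel. G z x) = \<tau> ^ CARD('n) * (LINT h|lborel. G (x + \<tau> *\<^sub>R h) x)"
      using lborel_integral_affine[of "\<lambda>z. G z x" \<tau> x] \<tau> by (simp add: G_def)
    also have "(\<lambda>h. G (x + \<tau> *\<^sub>R h) x) = (\<lambda>h. ((1/\<tau>) ^ CARD('n) * \<theta> x) * (\<eta> h * g (x + \<tau> *\<^sub>R h)))"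
      using \<tau> by (simp add: G_def fun_eq_iff mult_ac)
    also have "\<tau> ^ CARD('n) * (LINT h|lborel. ((1/\<tau>) ^ CARD('n) * \<theta> x) * (\<eta> h * g (x + \<tau> *\<^sub>R h)))
       = (\<tau> ^ CARD('n) * (1/\<tau>) ^ CARD('n)) * (\<theta> x * (LINT h|lborel. \<eta> h * g (x + \<tau> *\<^sub>R h)))"
      by simp
    also have "\<tau> ^ CARD('n) * (1/\<tau>) ^ CARD('n) = 1"
      using \<tau> by (simp add: power_mult_distrib[symmetric])
    finally show "(LINT z|lborel. G z x) = \<theta> x * (LINT h|lborel. \<eta> h * g (x + \<tau> *\<^sub>R h))" by simp
  qed
  finally show "(LINT z|lborel. g z * mollify \<tau> \<theta> z)
       = (LINT x|lborel. \<theta> x * (LINT h|lborel. \<eta> h * g (x + \<tau> *\<^sub>R h)))" .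
  define E where "E x h = \<theta> x * (\<eta> h * g (x + \<tau> *\<^sub>R h))" for x h
  have Em: "case_prod E \<in> borel_measurable borel"
    unfolding E_def borel_prod[symmetric] by measurable
  have Es: "E x h = 0" if "x \<notin> cball a \<delta> \<or> h \<notin> cball 0 K" for x h
    using that \<theta>' supp unfolding E_def by (auto simp: not_le)
  have Eb: "\<bar>E x h\<bar> \<le> H * (X * B)" for x h
  proof (cases "x \<in> cball a \<delta> \<and> h \<in> cball 0 K")
    case True
    then have "dist a (x + \<tau> *\<^sub>R h) \<le> \<delta> + K * \<tau>"
      using dist_triangle[of a "x + \<tau> *\<^sub>R h" x] \<tau> by (simp add: dist_norm mult.commute[of \<tau>])
        (smt (verit) mult_right_mono)
    then show ?thesis unfolding E_def abs_mult using \<theta>' X B B0 H X_nonneg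
      by (intro mult_mono) auto
  next
    case False
    then show ?thesis using Es[of x h] B0 X_nonneg H by auto
  qed
  have "(LINT x|lborel. \<theta> x * (LINT h|lborel. \<eta> h * g (x + \<tau> *\<^sub>R h))) = (LINT x|lborel. LINT h|lborel. E x h)"
    unfolding E_def by simp
  also have "\<dots> = (LINT h|lborel. LINT x|lborel. E x h)"
    using integral_swap_bounded_support[OF Em Eb, of a \<delta> 0 K] Es by simp
  also have "\<dots> = (LINT h|lborel. \<eta> h * (LINT x|lborel. g (x + \<tau> *\<^sub>R h) * \<theta> x))"
    unfolding E_def by (subst integral_mult_right_zero[symmetric]) (simp add: mult_ac)
  finally show "(LINT x|lborel. \<theta> x * (LINT h|lborel. \<eta> h * g (x + \<tau> *\<^sub>R h)))
       = (LINT h|lborel. \<eta> h * (LINT x|lborel. g (x + \<tau> *\<^sub>R h) * \<theta> x))" .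
  have "mollify \<tau> \<theta> \<in> borel_measurable lborel"
    unfolding mollify_def[abs_def] by measurable
  then show "mollify \<tau> \<theta> \<in> borel_measurable borel" by simp
qed

text \<open>The vanishing moments allow the Taylor polynomial of \<eta> to be subtracted under the
  integral. The remainder contributes (\<delta>/\<tau>)^N, and the volume of the support against
  \<tau>^(-n) contributes (\<delta>/\<tau>)^n.\<close>

lemma test_fun_mollify:
  assumes \<theta>: "test_fun N a \<delta> H \<theta>" and \<tau>: "\<tau> > 0" and \<delta>: "\<delta> > 0"
  shows "test_fun N a (\<delta> + K * \<tau>) (T * unit_ball_vol (real CARD('n)) * H * (\<delta>/\<tau>) ^ (CARD('n) + N)) (mollify \<tau> \<theta>)"
  unfolding test_fun_def
proof (intro conjI allI impI)
  note \<theta>' = \<theta>[unfolded test_fun_def]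
  have [measurable]: "\<theta> \<in> borel_measurable borel" using \<theta>' by auto
  have H: "H \<ge> 0" using \<theta>' abs_ge_zero order_trans by blast
  show "mollify \<tau> \<theta> \<in> borel_measurable borel"
    using mollify_integral(3)[OF \<theta> continuous_on_const \<tau>] .
  show "(LINT x|lborel. p x * mollify \<tau> \<theta> x) = 0" if p: "poly_lt N p" for p
  proof -
    have "(LINT x|lborel. p (x + \<tau> *\<^sub>R h) * \<theta> x) = 0" for h
      using \<theta>' poly_lt_affine[OF p, of "\<tau> *\<^sub>R h" 1] by (simp add: add.commute)
    then show ?thesis
      using mollify_integral(1,2)[OF \<theta> poly_lt_continuous[OF p] \<tau>] by simp
  qed
  fix z
  show "mollify \<tau> \<theta> z = 0" if "z \<notin> cball a (\<delta> + K * \<tau>)"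
  proof -
    have "\<eta> ((1/\<tau>) *\<^sub>R (z - x)) * \<theta> x = 0" for x
    proof (cases "x \<in> cball a \<delta>")
      case True
      then have "dist a z > \<delta> + K * \<tau>" "dist a x \<le> \<delta>" using that by auto
      then have "norm (z - x) > K * \<tau>"
        using dist_triangle[of a z x] by (simp add: dist_norm norm_minus_commute)
      then have "norm ((1/\<tau>) *\<^sub>R (z - x)) > K" using \<tau> unfolding norm_scaleR by (simp add: pos_less_divide_eq)
      then show ?thesis by (simp add: supp)
    qed (use \<theta>' in auto)
    then show ?thesis unfolding mollify_def by (simp only: Bochner_Integration.integral_zero mult_zero_right)
  qed
  obtain p where p: "poly_lt N p" and pb: "\<And>w. \<bar>\<eta> ((1/\<tau>) *\<^sub>R (z - a) + w) - p w\<bar> \<le> T * norm w ^ N"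
    using taylor by blast
  \<comment> \<open>The polynomial p at the displacement from (z - a)/\<tau> to (z - x)/\<tau>; in
    the variable x it still has degree below N.\<close>
  define q where "q x = p ((1/\<tau>) *\<^sub>R (a - x))" for x
  have qp: "poly_lt N q"
    using poly_lt_affine[OF p, of "(1/\<tau>) *\<^sub>R a" "-(1/\<tau>)"] unfolding q_def by (simp add: algebra_simps)
  have qm[measurable]: "q \<in> borel_measurable borel"
    using poly_lt_continuous[OF qp] by (rule borel_measurable_continuous_onI)
  have b: "\<bar>(\<eta> ((1/\<tau>) *\<^sub>R (z - x)) - q x) * \<theta> x\<bar> \<le> T * (\<delta>/\<tau>) ^ N * H" if "x \<in> cball a \<delta>" for x
  proof -
    have "(1/\<tau>) *\<^sub>R (z - x) = (1/\<tau>) *\<^sub>R (z - a) + (1/\<tau>) *\<^sub>R (a - x)"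
      by (simp add: algebra_simps)
    then have "\<bar>\<eta> ((1/\<tau>) *\<^sub>R (z - x)) - q x\<bar> \<le> T * norm ((1/\<tau>) *\<^sub>R (a - x)) ^ N"
      unfolding q_def using pb by metis
    also have "\<dots> \<le> T * (\<delta>/\<tau>) ^ N"
      using that \<tau> T_nonneg by (intro mult_left_mono power_mono) (auto simp: dist_norm divide_right_mono)
    finally show ?thesis
      unfolding abs_mult using \<theta>' T_nonneg \<tau> \<delta> H by (intro mult_mono) auto
  qed
  have z: "x \<notin> cball a \<delta> \<Longrightarrow> (\<eta> ((1/\<tau>) *\<^sub>R (z - x)) - q x) * \<theta> x = 0" for x
    using \<theta>' by auto
  have i1: "integrable lborel (\<lambda>x. (\<eta> ((1/\<tau>) *\<^sub>R (z - x)) - q x) * \<theta> x)"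
  proof (rule integrable_bounded_support[where A="cball a \<delta>" and B="T * (\<delta>/\<tau>) ^ N * H"])
    show "\<bar>(\<eta> ((1/\<tau>) *\<^sub>R (z - x)) - q x) * \<theta> x\<bar> \<le> T * (\<delta>/\<tau>) ^ N * H" for x
    proof (cases "x \<in> cball a \<delta>")
      case False
      then show ?thesis unfolding z[OF False] using T_nonneg \<tau> \<delta> H by simp
    qed (rule b)
  qed (use z in auto)
  have i2: "integrable lborel (\<lambda>x. \<eta> ((1/\<tau>) *\<^sub>R (z - x)) * \<theta> x)"
  proof (rule integrable_bounded_support[where A="cball a \<delta>" and B="X * H"])
    show "\<bar>\<eta> ((1/\<tau>) *\<^sub>R (z - x)) * \<theta> x\<bar> \<le> X * H" for x
      unfolding abs_mult using \<theta>' X X_nonneg by (intro mult_mono) auto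
  qed (use \<theta>' in auto)
  have "(LINT x|lborel. (\<eta> ((1/\<tau>) *\<^sub>R (z - x)) - q x) * \<theta> x)
      = (LINT x|lborel. \<eta> ((1/\<tau>) *\<^sub>R (z - x)) * \<theta> x) - (LINT x|lborel. q x * \<theta> x)"
    unfolding left_diff_distrib
    using Bochner_Integration.integral_diff[OF i2, of "\<lambda>x. q x * \<theta> x"]
      Bochner_Integration.integrable_diff[OF i2 i1] by (simp add: algebra_simps)
  also have "(LINT x|lborel. q x * \<theta> x) = 0" using \<theta>' qp by auto
  finally have e: "(LINT x|lborel. \<eta> ((1/\<tau>) *\<^sub>R (z - x)) * \<theta> x)
      = (LINT x|lborel. (\<eta> ((1/\<tau>) *\<^sub>R (z - x)) - q x) * \<theta> x)" by simp
  have "\<bar>LINT x|lborel. \<eta> ((1/\<tau>) *\<^sub>R (z - x)) * \<theta> x\<bar> \<le> T * (\<delta>/\<tau>) ^ N * H * (unit_ball_vol (real CARD('n)) * \<delta> ^ CARD('n))"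
    unfolding e using abs_integral_le_cball[of a \<delta> "\<lambda>x. (\<eta> ((1/\<tau>) *\<^sub>R (z - x)) - q x) * \<theta> x", OF b z] \<delta> by simp
  then have "\<bar>mollify \<tau> \<theta> z\<bar> \<le> (1/\<tau>) ^ CARD('n) * (T * (\<delta>/\<tau>) ^ N * H * (unit_ball_vol (real CARD('n)) * \<delta> ^ CARD('n)))"
    unfolding mollify_def abs_mult using \<tau> by (intro mult_mono) auto
  also have "\<dots> = T * unit_ball_vol (real CARD('n)) * H * (\<delta>/\<tau>) ^ (CARD('n) + N)"
    by (simp add: power_add power_divide)
  finally show "\<bar>mollify \<tau> \<theta> z\<bar> \<le> T * unit_ball_vol (real CARD('n)) * H * (\<delta>/\<tau>) ^ (CARD('n) + N)" .
qed

lemma integral_test_fun_le: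
  fixes f :: "real^'n \<Rightarrow> real"
  assumes \<theta>: "test_fun N a \<delta> H \<theta>" and f: "\<And>x. \<bar>f x\<bar> \<le> F" and \<delta>: "\<delta> \<ge> 0"
  shows "\<bar>LINT x|lborel. f x * \<theta> x\<bar> \<le> F * H * (unit_ball_vol (real CARD('n)) * \<delta> ^ CARD('n))"
proof -
  have "\<bar>f x * \<theta> x\<bar> \<le> F * H" for x
    unfolding abs_mult using f[of x] \<theta> by (intro mult_mono) (auto simp: test_fun_def)
  then show ?thesis
    using abs_integral_le_cball[of a \<delta> "\<lambda>x. f x * \<theta> x" "F * H"] \<theta> \<delta> by (simp add: test_fun_def)
qed

text \<open>As \<eta> has integral 1, the term q = 0 of the averaged difference is f itself. Moving
  the terms q >= 1 onto \<theta> leaves only the averaged difference, and the support of \<eta>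
  restricts its steps to length at most K t.\<close>

lemma test_fun_integral_split:
  fixes f :: "real^'n \<Rightarrow> real"
  assumes f: "continuous_on UNIV f" "\<And>x. \<bar>f x\<bar> \<le> F"
    and diff: "\<And>x h. norm h \<le> K * t \<Longrightarrow> \<bar>diffk N h f x\<bar> \<le> W"
    and \<theta>: "test_fun N a \<delta> H \<theta>" and t: "t > 0" and \<delta>: "\<delta> > 0" and W: "W \<ge> 0"
  shows "\<bar>(LINT x|lborel. f x * \<theta> x)
      + (\<Sum>q<N. (-1) ^ Suc q * real (N choose Suc q) * (LINT z|lborel. f z * mollify (real (Suc q) * t) \<theta> z))\<bar>
     \<le> H * (X * W * (unit_ball_vol (real CARD('n)) * K ^ CARD('n))) * (unit_ball_vol (real CARD('n)) * \<delta> ^ CARD('n))"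
proof -
  note \<theta>' = \<theta>[unfolded test_fun_def]
  have [measurable]: "\<theta> \<in> borel_measurable borel" "f \<in> borel_measurable borel"
    using \<theta>' borel_measurable_continuous_onI[OF f(1)] by auto
  have H: "H \<ge> 0" using \<theta>' abs_ge_zero order_trans by blast
  have F: "F \<ge> 0" using f(2) abs_ge_zero order_trans by blast
  let ?c = "\<lambda>q. (-1) ^ q * real (N choose q)"
  define G where "G q x = (LINT h|lborel. \<eta> h * f (x + (real q * t) *\<^sub>R h))" for q x
  have b: "\<bar>\<eta> h * f (x + c *\<^sub>R h)\<bar> \<le> X * F" for h x c
    unfolding abs_mult using f X X_nonneg by (intro mult_mono) auto
  have z: "h \<notin> cball 0 K \<Longrightarrow> \<eta> h * y = 0" for h y using supp by auto
  have i: "integrable lborel (\<lambda>h. \<eta> h * f (x + c *\<^sub>R h))" for x c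
    by (rule integrable_bounded_support[OF _ b compact_cball[of 0 K] z]) auto
  have Gb: "\<bar>G q x\<bar> \<le> X * F * (unit_ball_vol (real CARD('n)) * K ^ CARD('n))" for q x
    unfolding G_def using abs_integral_le_cball[of 0 K "\<lambda>h. \<eta> h * f (x + (real q * t) *\<^sub>R h)", OF b z] K by simp
  have Gm[measurable]: "G q \<in> borel_measurable borel" for q
  proof -
    have "G q \<in> borel_measurable lborel"
      unfolding G_def[abs_def] by measurable
    then show ?thesis by simp
  qed
  have GI: "integrable lborel (\<lambda>x. \<theta> x * G q x)" for q
  proof (rule integrable_bounded_support[where A="cball a \<delta>"])
    show "\<bar>\<theta> x * G q x\<bar> \<le> H * (X * F * (unit_ball_vol (real CARD('n)) * K ^ CARD('n)))" for x
      unfolding abs_mult using \<theta>' Gb[of q x] H by (intro mult_mono) auto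
  qed (use \<theta>' in auto)
  have G0: "G 0 x = f x" for x
    by (simp add: G_def int_one)
  have GS: "(LINT z|lborel. f z * mollify (real (Suc q) * t) \<theta> z) = (LINT x|lborel. \<theta> x * G (Suc q) x)" for q
    unfolding G_def using mollify_integral(1)[OF \<theta> f(1), of "real (Suc q) * t"] t by simp
  have "(LINT x|lborel. f x * \<theta> x)
      + (\<Sum>q<N. ?c (Suc q) * (LINT z|lborel. f z * mollify (real (Suc q) * t) \<theta> z))
      = (\<Sum>q\<le>N. ?c q * (LINT x|lborel. \<theta> x * G q x))"
    unfolding GS sum.atMost_shift by (simp add: G0 mult.commute)
  also have "\<dots> = (LINT x|lborel. (\<Sum>q\<le>N. ?c q * (\<theta> x * G q x)))"
    by (subst Bochner_Integration.integral_sum) (auto intro: GI)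
  also have "\<dots> = (LINT x|lborel. \<theta> x * (\<Sum>q\<le>N. ?c q * G q x))"
    by (simp add: sum_distrib_left mult_ac)
  finally have eq: "(LINT x|lborel. f x * \<theta> x)
      + (\<Sum>q<N. ?c (Suc q) * (LINT z|lborel. f z * mollify (real (Suc q) * t) \<theta> z))
      = (LINT x|lborel. \<theta> x * (\<Sum>q\<le>N. ?c q * G q x))" .
  have D: "\<bar>\<Sum>q\<le>N. ?c q * G q x\<bar> \<le> X * W * (unit_ball_vol (real CARD('n)) * K ^ CARD('n))" for x
  proof -
    have "(\<Sum>q\<le>N. ?c q * G q x) = (LINT h|lborel. (\<Sum>q\<le>N. ?c q * (\<eta> h * f (x + (real q * t) *\<^sub>R h))))"
      unfolding G_def by (subst Bochner_Integration.integral_sum) (auto intro: i)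
    also have "(\<lambda>h. \<Sum>q\<le>N. ?c q * (\<eta> h * f (x + (real q * t) *\<^sub>R h)))
        = (\<lambda>h. \<eta> h * diffk N (- (t *\<^sub>R h)) f (x + (real N / 2) *\<^sub>R (t *\<^sub>R h)))"
      unfolding forward_difference_eq_diffk[symmetric] by (simp add: sum_distrib_left mult_ac)
    finally have e: "(\<Sum>q\<le>N. ?c q * G q x)
        = (LINT h|lborel. \<eta> h * diffk N (- (t *\<^sub>R h)) f (x + (real N / 2) *\<^sub>R (t *\<^sub>R h)))" .
    have "\<bar>\<eta> h * diffk N (- (t *\<^sub>R h)) f (x + (real N / 2) *\<^sub>R (t *\<^sub>R h))\<bar> \<le> X * W" if "h \<in> cball 0 K" for h
      unfolding abs_mult using X X_nonneg t that
      by (intro mult_mono diff) (auto simp: mult.commute)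
    then show ?thesis
      unfolding e using K abs_integral_le_cball[of 0 K "\<lambda>h. \<eta> h * diffk N (- (t *\<^sub>R h)) f (x + (real N / 2) *\<^sub>R (t *\<^sub>R h))" "X * W"] z
      by simp
  qed
  have "\<bar>\<theta> x * (\<Sum>q\<le>N. ?c q * G q x)\<bar> \<le> H * (X * W * (unit_ball_vol (real CARD('n)) * K ^ CARD('n)))" for x
    unfolding abs_mult[of "\<theta> x"] using D \<theta>' H by (intro mult_mono) auto
  then show ?thesis
    unfolding eq using abs_integral_le_cball[of a \<delta> "\<lambda>x. \<theta> x * (\<Sum>q\<le>N. ?c q * G q x)"
        "H * (X * W * (unit_ball_vol (real CARD('n)) * K ^ CARD('n)))"] \<theta>' \<delta> by simp
qed

theorem vanishing_moments_decay:
  fixes f :: "real^'n \<Rightarrow> real"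
  assumes f: "continuous_on UNIV f" "\<And>x. \<bar>f x\<bar> \<le> F"
    and s: "0 < s" "s < real N"
    and diff: "\<And>x h. norm h \<le> 1 \<Longrightarrow> \<bar>diffk N h f x\<bar> \<le> A * norm h powr s"
  shows "\<exists>C\<ge>0. \<forall>a \<delta> H \<theta>. \<delta> > 0 \<longrightarrow> test_fun N a \<delta> H \<theta> \<longrightarrow>
           \<bar>LINT x|lborel. f x * \<theta> x\<bar> \<le> C * H * (\<delta> ^ CARD('n) * \<delta> powr s)"
proof -
  define V where "V = unit_ball_vol (real CARD('n))"
  define n where "n = CARD('n)"
  have V: "V \<ge> 0" by (simp add: V_def)
  have F: "F \<ge> 0" using f(2) abs_ge_zero order_trans by blast
  have A: "A \<ge> 0"
  proof -
    obtain h :: "real^'n" where "norm h = 1" using vector_choose_size[of 1] by auto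
    with diff[of h 0] show ?thesis by simp
  qed
  \<comment> \<open>Loss of one step apart from powers of \<mu>: 2^N bounds the binomial
    coefficients, T V comes from \<open>test_fun_mollify\<close>, and the rest from l <= (1 + N K)
    \<mu>.\<close>
  define E where "E = 2 ^ N * T * V * (1 + N * K) ^ n * (1 + N * K) powr s"
  have E: "E \<ge> 0" using T_nonneg V K by (simp add: E_def)
  \<comment> \<open>A step has the net factor E \<mu>^(s-N). As s < N, a large \<mu> makes it at
    most 1/2; 2 E + 1 keeps the base positive when E = 0.\<close>
  define \<mu> where "\<mu> = max 1 ((2 * E + 1) powr (1 / (N - s)))"
  have \<mu>1: "\<mu> \<ge> 1" by (simp add: \<mu>_def)
  have \<mu>: "E * \<mu> powr (s - N) \<le> 1/2"
  proof -
    have "\<mu> powr (s - N) \<le> ((2 * E + 1) powr (1 / (N - s))) powr (s - N)"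
      using s E by (intro powr_mono2') (auto simp: \<mu>_def)
    also have "\<dots> = (2 * E + 1) powr (-1)"
    proof -
      have "1 / (real N - s) * (s - real N) = -1" using s by (simp add: divide_eq_eq)
      then show ?thesis unfolding powr_powr by (rule arg_cong)
    qed
    also have "\<dots> = 1 / (2 * E + 1)" using E by (simp add: powr_minus field_simps)
    finally have "E * \<mu> powr (s - N) \<le> E * (1 / (2 * E + 1))" using E by (intro mult_left_mono)
    also have "\<dots> \<le> 1/2" using E by (simp add: field_simps)
    finally show ?thesis .
  qed
  \<comment> \<open>Growth of the radius in one step: with t = \<mu> \<delta>, the widest
    mollification has scale N t and enlarges the radius to l \<delta>.\<close>
  define l where "l = 1 + N * K * \<mu>"
  have Npos: "N \<ge> 1" using s by (cases N) auto
  have l1: "l > 1" using K \<mu>1 Npos by (simp add: l_def)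
  define C1 where "C1 = X * V * K ^ n * V * (A * (K * \<mu>) powr s)"
  have C1: "C1 \<ge> 0" using X_nonneg V K A by (simp add: C1_def)
  \<comment> \<open>Twice \<open>C1\<close> lets half of C absorb the averaged difference, the other
    half being left for the recursive terms. The last summand is the trivial bound for l \<delta> >=
    1.\<close>
  define C where "C = 2 * C1 + F * V * l powr s"
  have C: "C \<ge> 0" using C1 F V by (simp add: C_def)
  have triv: "\<bar>LINT x|lborel. f x * \<theta> x\<bar> \<le> C * H * (\<delta> ^ n * \<delta> powr s)"
    if \<delta>: "l * \<delta> \<ge> 1" "\<delta> > 0" and \<theta>: "test_fun N a \<delta> H \<theta>" for a \<delta> H \<theta>
  proof -
    have H: "H \<ge> 0" using \<theta>[unfolded test_fun_def] abs_ge_zero order_trans by blast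
    have "\<bar>LINT x|lborel. f x * \<theta> x\<bar> \<le> F * H * (V * \<delta> ^ n)"
      using integral_test_fun_le[OF \<theta> f(2)] \<delta> by (simp add: V_def n_def)
    also have "\<dots> = F * V * (H * \<delta> ^ n) * 1" by simp
    also have "\<dots> \<le> F * V * (H * \<delta> ^ n) * (l * \<delta>) powr s"
      using F V H \<delta> s by (intro mult_left_mono ge_one_powr_ge_zero) auto
    also have "\<dots> = (F * V * l powr s) * (H * (\<delta> ^ n * \<delta> powr s))"
      using l1 \<delta> by (simp add: powr_mult)
    also have "\<dots> \<le> C * (H * (\<delta> ^ n * \<delta> powr s))"
      using C1 H \<delta> by (intro mult_right_mono) (auto simp: C_def)
    finally show ?thesis by simp
  qed
  \<comment> \<open>Induction on the number m of enlargements by l that bring the radius up to 1;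
    the test function varies because the induction hypothesis is applied to its mollifications of
    radius at most l \<delta>.\<close>
  have main: "\<bar>LINT x|lborel. f x * \<theta> x\<bar> \<le> C * H * (\<delta> ^ n * \<delta> powr s)"
    if "\<delta> > 0" "l ^ m * \<delta> \<ge> 1" "test_fun N a \<delta> H \<theta>" for m a \<delta> H \<theta>
    using that
  proof (induction m arbitrary: a \<delta> H \<theta>)
    case 0
    then have "l * \<delta> \<ge> 1" using l1 by (simp add: less_eq_real_def) (smt (verit) mult_le_cancel_right1)
    with 0 show ?case by (intro triv)
  next
    case (Suc m)
    note \<delta> = \<open>\<delta> > 0\<close> and \<theta> = \<open>test_fun N a \<delta> H \<theta>\<close>
    have H: "H \<ge> 0" using \<theta>[unfolded test_fun_def] abs_ge_zero order_trans by blast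
    show ?case
    proof (cases "l * \<delta> \<ge> 1")
      case True
      then show ?thesis using \<delta> \<theta> by (intro triv)
    next
      case False
      define t where "t = \<mu> * \<delta>"
      have t: "t > 0" using \<mu>1 \<delta> by (simp add: t_def)
      have "K * t \<le> l * \<delta>"
      proof -
        have "1 * (K * \<mu>) \<le> real N * (K * \<mu>)" using Npos K \<mu>1 by (intro mult_right_mono) auto
        then have "K * \<mu> \<le> l" by (simp add: l_def mult.assoc)
        then show ?thesis using \<delta> by (simp add: t_def mult.assoc[symmetric])
      qed
      \<comment> \<open>The hypothesis on f covers only steps of length at most 1, which is why
        radii with l \<delta> >= 1 are treated separately.\<close>
      then have Kt: "K * t \<le> 1" using False by simp
      define W where "W = A * (K * t) powr s"
      have W: "\<bar>diffk N h f x\<bar> \<le> W" if "norm h \<le> K * t" for x h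
      proof -
        have "\<bar>diffk N h f x\<bar> \<le> A * norm h powr s" using that Kt by (intro diff) simp
        also have "\<dots> \<le> W" unfolding W_def using A s that by (intro mult_left_mono powr_mono2) auto
        finally show ?thesis .
      qed
      have W0: "W \<ge> 0" using A by (simp add: W_def)
      define M where "M q = (LINT z|lborel. f z * mollify (real (Suc q) * t) \<theta> z)" for q
      have Mb: "\<bar>M q\<bar> \<le> C * (T * V * H * (1/\<mu>) ^ (n + N)) * ((l * \<delta>) ^ n * (l * \<delta>) powr s)" if q: "q < N" for q
      proof -
        let ?\<tau> = "real (Suc q) * t"
        have \<tau>: "?\<tau> > 0" using t by simp
        have "real (Suc q) * (K * t) \<le> real N * (K * t)"
          using q K t by (intro mult_right_mono) auto
        then have le: "\<delta> + K * ?\<tau> \<le> l * \<delta>"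
          by (simp add: l_def t_def algebra_simps)
        have tf: "test_fun N a (l * \<delta>) (T * V * H * (\<delta>/?\<tau>) ^ (n + N)) (mollify ?\<tau> \<theta>)"
          using test_fun_mono[OF test_fun_mollify[OF \<theta> \<tau> \<delta>] le] by (simp only: V_def n_def)
        have "\<bar>M q\<bar> \<le> C * (T * V * H * (\<delta>/?\<tau>) ^ (n + N)) * ((l * \<delta>) ^ n * (l * \<delta>) powr s)"
          unfolding M_def using Suc.prems l1 \<delta> by (intro Suc.IH[OF _ _ tf]) (auto simp: mult_ac)
        also have "\<dots> \<le> C * (T * V * H * (1/\<mu>) ^ (n + N)) * ((l * \<delta>) ^ n * (l * \<delta>) powr s)"
        proof -
          have "\<delta>/?\<tau> \<le> 1/\<mu>"
          proof -
            have "1 * t \<le> ?\<tau>" using t by (intro mult_right_mono) auto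
            then have "\<mu> * \<delta> \<le> ?\<tau>" by (simp add: t_def)
            then have "\<delta>/?\<tau> \<le> \<delta>/(\<mu> * \<delta>)" using \<delta> \<mu>1 by (intro divide_left_mono mult_pos_pos) (auto simp: t_def)
            then show ?thesis using \<delta> by simp
          qed
          then show ?thesis
            using C T_nonneg V H l1 \<delta> \<mu>1 t
            by (intro mult_right_mono mult_left_mono power_mono) (auto)
        qed
        finally show ?thesis .
      qed
      have "\<bar>\<Sum>q<N. (-1) ^ Suc q * real (N choose Suc q) * M q\<bar>
          \<le> (\<Sum>q<N. real (N choose Suc q) * (C * (T * V * H * (1/\<mu>) ^ (n + N)) * ((l * \<delta>) ^ n * (l * \<delta>) powr s)))"
        proof (rule order_trans[OF sum_abs sum_mono])
        fix q assume "q \<in> {..<N}"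
        then have "real (N choose Suc q) * \<bar>M q\<bar> \<le> real (N choose Suc q) * (C * (T * V * H * (1/\<mu>) ^ (n + N)) * ((l * \<delta>) ^ n * (l * \<delta>) powr s))"
          by (intro mult_left_mono Mb) auto
        then show "\<bar>(-1) ^ Suc q * real (N choose Suc q) * M q\<bar> \<le> real (N choose Suc q) * (C * (T * V * H * (1/\<mu>) ^ (n + N)) * ((l * \<delta>) ^ n * (l * \<delta>) powr s))"
          by (simp only: abs_mult power_abs abs_minus_cancel abs_one power_one mult_1_left abs_of_nat)
      qed
      also have "\<dots> = (\<Sum>q<N. real (N choose Suc q)) * (C * (T * V * H * (1/\<mu>) ^ (n + N)) * ((l * \<delta>) ^ n * (l * \<delta>) powr s))"
        by (simp add: sum_distrib_right)
      also have "\<dots> \<le> 2 ^ N * (C * (T * V * H * (1/\<mu>) ^ (n + N)) * ((l * \<delta>) ^ n * (l * \<delta>) powr s))"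
      proof (rule mult_right_mono)
        have "(\<Sum>q\<le>N. N choose q) = 1 + (\<Sum>q<N. N choose Suc q)"
          by (simp add: sum.atMost_shift)
        then have "(\<Sum>q<N. N choose Suc q) \<le> 2 ^ N" by (simp add: choose_row_sum)
        then have "real (\<Sum>q<N. N choose Suc q) \<le> real (2 ^ N)" by (rule of_nat_mono)
        then show "(\<Sum>q<N. real (N choose Suc q)) \<le> 2 ^ N" by simp
        show "0 \<le> C * (T * V * H * (1/\<mu>) ^ (n + N)) * ((l * \<delta>) ^ n * (l * \<delta>) powr s)"
          using C T_nonneg V H l1 \<delta> \<mu>1 by simp
      qed
      also have "\<dots> = 2 ^ N * T * V * ((1/\<mu>) ^ (n + N) * (l ^ n * l powr s)) * (C * H * (\<delta> ^ n * \<delta> powr s))"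
        using l1 \<delta> by (simp add: powr_mult power_mult_distrib)
      also have "\<dots> \<le> 2 ^ N * T * V * ((1/\<mu>) ^ (n + N) * (((1 + N * K) * \<mu>) ^ n * ((1 + N * K) * \<mu>) powr s)) * (C * H * (\<delta> ^ n * \<delta> powr s))"
      proof -
        have "l \<le> (1 + N * K) * \<mu>" using \<mu>1 by (simp add: l_def algebra_simps)
        then show ?thesis
          using C T_nonneg V H l1 \<delta> \<mu>1 s
          by (intro mult_right_mono mult_left_mono mult_mono power_mono powr_mono2) auto
      qed
      also have "\<dots> = E * \<mu> powr (s - N) * (C * H * (\<delta> ^ n * \<delta> powr s))"
      proof -
        have "(1/\<mu>) ^ (n + N) * (\<mu> ^ n * \<mu> powr s) = \<mu> powr (s - N)"
          using \<mu>1 by (simp add: power_add powr_diff powr_realpow power_divide)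
        moreover have "((1 + N * K) * \<mu>) powr s = (1 + N * K) powr s * \<mu> powr s"
          using \<mu>1 K by (simp add: powr_mult)
        ultimately show ?thesis by (simp add: E_def power_mult_distrib)
      qed
      also have "\<dots> \<le> 1/2 * (C * H * (\<delta> ^ n * \<delta> powr s))"
        using C H \<delta> by (intro mult_right_mono \<mu>) auto
      finally have S2: "\<bar>\<Sum>q<N. (-1) ^ Suc q * real (N choose Suc q) * M q\<bar> \<le> 1/2 * (C * H * (\<delta> ^ n * \<delta> powr s))" .
      have "\<bar>(LINT x|lborel. f x * \<theta> x) + (\<Sum>q<N. (-1) ^ Suc q * real (N choose Suc q) * M q)\<bar>
          \<le> H * (X * W * (V * K ^ n)) * (V * \<delta> ^ n)"
        unfolding M_def V_def n_def by (rule test_fun_integral_split[OF f W \<theta> t \<delta> W0])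
      also have "\<dots> = C1 * H * (\<delta> ^ n * \<delta> powr s)"
      proof -
        have "W = A * ((K * \<mu>) powr s * \<delta> powr s)"
          using K \<mu>1 \<delta> by (simp add: W_def t_def powr_mult mult_ac)
        then show ?thesis by (simp add: C1_def)
      qed
      also have "\<dots> \<le> 1/2 * C * H * (\<delta> ^ n * \<delta> powr s)"
        using H \<delta> F V by (intro mult_right_mono) (auto simp: C_def)
      finally show ?thesis using S2 by linarith
    qed
  qed
  have "\<bar>LINT x|lborel. f x * \<theta> x\<bar> \<le> C * H * (\<delta> ^ n * \<delta> powr s)"
    if \<delta>: "\<delta> > 0" and \<theta>: "test_fun N a \<delta> H \<theta>" for a \<delta> H \<theta>
  proof -
    obtain m where "l ^ m > 1 / \<delta>" using real_arch_pow[OF l1] by auto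
    then have "l ^ m * \<delta> \<ge> 1" using \<delta> by (simp add: field_simps)
    then show ?thesis using main \<delta> \<theta> by blast
  qed
  then show ?thesis using C unfolding n_def by blast
qed

end

section \<open>Wavelet expansions of bounded functions\<close>

lemma intvec_nth: "intvec k $ i = real_of_int (k i)"
  by (simp add: intvec_def)

lemma card_int_near:
  assumes "K \<ge> 0"
  shows "finite {m::int. \<bar>a - real_of_int m\<bar> \<le> K}" "real (card {m::int. \<bar>a - real_of_int m\<bar> \<le> K}) \<le> 2 * K + 1"
proof -
  have e: "{m::int. \<bar>a - real_of_int m\<bar> \<le> K} = {\<lceil>a - K\<rceil>..\<lfloor>a + K\<rfloor>}"
    by (auto simp: ceiling_le_iff le_floor_iff abs_le_iff)
  show "finite {m::int. \<bar>a - real_of_int m\<bar> \<le> K}" unfolding e by simp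
  have "real_of_int (\<lfloor>a + K\<rfloor> - \<lceil>a - K\<rceil> + 1) \<le> 2 * K + 1"
    using of_int_floor_le[of "a + K"] le_of_int_ceiling[of "a - K"] by (simp del: of_int_floor_le le_of_int_ceiling)
  then show "real (card {m::int. \<bar>a - real_of_int m\<bar> \<le> K}) \<le> 2 * K + 1"
    unfolding e using assms by simp
qed

lemma card_intvec_near:
  fixes a :: "real^'n"
  assumes "K \<ge> 0"
  shows "finite {k. norm (a - intvec k) \<le> K}" "real (card {k. norm (a - intvec k) \<le> K}) \<le> (2 * K + 1) ^ CARD('n)"
proof -
  let ?P = "PiE (UNIV::'n set) (\<lambda>i. {m::int. \<bar>a $ i - real_of_int m\<bar> \<le> K})"
  have sub: "{k. norm (a - intvec k) \<le> K} \<subseteq> ?P"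
  proof -
    have "\<bar>a $ i - real_of_int (k i)\<bar> \<le> K" if "norm (a - intvec k) \<le> K" for k i
      using component_le_norm_cart[of "a - intvec k" i] that by (simp add: intvec_nth)
    then show ?thesis by auto
  qed
  have fin: "finite ?P" by (intro finite_PiE) (auto simp: card_int_near assms)
  show "finite {k. norm (a - intvec k) \<le> K}" using finite_subset[OF sub fin] .
  have "real (card {k. norm (a - intvec k) \<le> K}) \<le> real (card ?P)"
    using card_mono[OF fin sub] by simp
  also have "\<dots> = (\<Prod>i\<in>UNIV. real (card {m::int. \<bar>a $ i - real_of_int m\<bar> \<le> K}))"
    by (simp add: card_PiE)
  also have "\<dots> \<le> (\<Prod>i\<in>(UNIV::'n set). 2 * K + 1)"
    by (intro prod_mono) (auto simp: card_int_near assms)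
  finally show "real (card {k. norm (a - intvec k) \<le> K}) \<le> (2 * K + 1) ^ CARD('n)" by simp
qed

text \<open>The support condition is on the products, so either factor may have the compact support:
  below it is sometimes the partial sums and sometimes the function they are tested against.\<close>

lemma integral_uniform_limit:
  fixes U v :: "'a::euclidean_space \<Rightarrow> real"
  assumes ul: "uniform_limit UNIV S U sequentially"
    and cS: "\<And>n. continuous_on UNIV (S n)" and cv: "continuous_on UNIV v"
    and zS: "\<And>n x. x \<notin> cball a R \<Longrightarrow> S n x * v x = 0"
    and zU: "\<And>x. x \<notin> cball a R \<Longrightarrow> U x * v x = 0"
    and B: "\<And>x. \<bar>v x\<bar> \<le> B" and R: "R \<ge> 0"
  shows "(\<lambda>n. LINT x|lborel. S n x * v x) \<longlonglongrightarrow> (LINT x|lborel. U x * v x)"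
proof (rule tendstoI)
  fix e :: real assume e: "e > 0"
  let ?V = "unit_ball_vol (real DIM('a)) * R ^ DIM('a)"
  have V: "?V \<ge> 0" using R by simp
  have B0: "B \<ge> 0" using B[of a] by linarith
  define d where "d = e / (B * ?V + 1)"
  have d: "d > 0" using e V B0 by (auto simp: d_def intro!: divide_pos_pos add_nonneg_pos)
  have cU: "continuous_on UNIV U"
    by (rule uniform_limit_theorem[OF _ ul]) (use cS in auto)
  have iU: "integrable lborel (\<lambda>x. U x * v x)"
    by (rule integrable_continuous_bounded_support[OF _ zU]) (intro continuous_intros cU cv)
  have iS: "integrable lborel (\<lambda>x. S n x * v x)" for n
    by (rule integrable_continuous_bounded_support[OF _ zS]) (intro continuous_intros cS cv)
  have "\<forall>\<^sub>F n in sequentially. \<forall>x\<in>UNIV. dist (S n x) (U x) < d"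
    using ul d by (rule uniform_limitD)
  then show "\<forall>\<^sub>F n in sequentially. dist (LINT x|lborel. S n x * v x) (LINT x|lborel. U x * v x) < e"
  proof eventually_elim
    case (elim n)
    have 1: "\<bar>S n x * v x - U x * v x\<bar> \<le> d * B" for x
    proof -
      have "\<bar>S n x * v x - U x * v x\<bar> = \<bar>S n x - U x\<bar> * \<bar>v x\<bar>" by (simp add: abs_mult[symmetric] algebra_simps)
      also have "\<dots> \<le> d * B" using elim B[of x] d by (intro mult_mono) (auto simp: dist_real_def less_imp_le)
      finally show ?thesis .
    qed
    have "\<bar>LINT x|lborel. S n x * v x - U x * v x\<bar> \<le> d * B * ?V"
      by (rule abs_integral_le_cball[of a R, OF 1]) (simp_all add: zS[unfolded mem_cball] zU[unfolded mem_cball] R del: mult_eq_0_iff)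
    also have "\<dots> < e"
    proof -
      have "d * B * ?V < d * (B * ?V + 1)" using d by (simp add: algebra_simps)
      also have "\<dots> = e" unfolding d_def using V B0 by (simp add: add_nonneg_eq_0_iff)
      finally show ?thesis .
    qed
    finally show ?case by (simp add: dist_real_def iU iS)
  qed
qed

text \<open>Cones are Lipschitz with compact support, the class for which the wavelet series is
  accessible. If d were nonzero at x0, a narrow cone there would see only one sign.\<close>

lemma eq_0_if_orthogonal_to_cones:
  fixes d :: "'a::euclidean_space \<Rightarrow> real"
  assumes cd: "continuous_on UNIV d"
    and orth: "\<And>x0 \<rho>. \<rho> > 0 \<Longrightarrow> (LINT x|lborel. d x * max 0 (\<rho> - dist x x0)) = 0"
  shows "d x0 = 0"
proof (rule ccontr)
  assume nz: "d x0 \<noteq> 0"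
  define c where "c = sgn (d x0)"
  have "isCont (\<lambda>x. c * d x) x0"
    using cd by (simp add: continuous_on_eq_continuous_at)
  moreover have "c * d x0 > 0" using nz by (simp add: c_def sgn_mult_self_eq abs_sgn[symmetric] mult.commute)
  ultimately have "\<forall>\<^sub>F x in nhds x0. c * d x > 0"
    unfolding isCont_def by (metis order_tendstoD(1) eventually_nhds_conv_at)
  then obtain \<rho> where \<rho>: "\<rho> > 0" and pos: "\<And>x. dist x x0 < \<rho> \<Longrightarrow> c * d x > 0"
    by (auto simp: eventually_nhds_metric)
  let ?u = "\<lambda>x. max 0 (\<rho> - dist x x0)"
  have int: "integrable lborel (\<lambda>x. c * d x * ?u x)"
    by (rule integrable_continuous_bounded_support[of _ x0 \<rho>])
       (auto intro!: continuous_intros cd simp: dist_commute)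
  have nn: "c * d x * ?u x \<ge> 0" for x
    using pos[of x] by (cases "dist x x0 < \<rho>") (auto intro: mult_nonneg_nonneg less_imp_le)
  have "(LINT x|lborel. c * d x * ?u x) = 0"
    using orth[OF \<rho>, of x0] by (simp add: mult.assoc)
  then have "AE x in lborel. c * d x * ?u x = 0"
    using integral_nonneg_eq_0_iff_AE[OF int] nn by simp
  then have "AE x in lborel. x \<notin> ball x0 \<rho>"
  proof eventually_elim
    case (elim x)
    show ?case
    proof
      assume "x \<in> ball x0 \<rho>"
      then have "dist x x0 < \<rho>" by (simp add: dist_commute)
      with pos[of x] have "c * d x * ?u x > 0" by (intro mult_pos_pos[of "c * d x"]) auto
      with elim show False by (simp only: less_irrefl)
    qed
  qed
  then have "emeasure lborel (ball x0 \<rho>) = 0"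
    by (subst (asm) AE_iff_measurable[of "ball x0 \<rho>"]) auto
  then have "measure lborel (ball x0 \<rho>) = 0" by (simp add: measure_def)
  then show False using \<rho> by simp
qed

text \<open>On \<open>Omega\<close> this is \<open>psiw\<close> with the scaling function stored as
  type 0: type 0 occurs only at scale 0, where the dyadic factors are 1. Estimates then need no case
  distinction.\<close>

definition wav :: "(nat \<Rightarrow> real^'n \<Rightarrow> real) \<Rightarrow> nat \<times> nat \<times> ('n \<Rightarrow> int) \<Rightarrow> real^'n \<Rightarrow> real" where
  "wav \<Psi> w x = (case w of (l, i, k) \<Rightarrow>
     2 powr (real i * real CARD('n) / 2) * \<Psi> l ((2 ^ i) *\<^sub>R x - intvec k))"

text \<open>What the expansion itself uses. Smoothness and higher moments enter later as hypotheses
  of \<open>holder_decay\<close>; \<open>mean\<close> leaves out type 0, whose integral is shown to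
  be nonzero in \<open>scaling_function_mean\<close>.\<close>

locale wavelet_basis =
  fixes \<Psi> :: "nat \<Rightarrow> real^'n \<Rightarrow> real" and K M :: real
  assumes cont: "l < 2 ^ CARD('n) \<Longrightarrow> continuous_on UNIV (\<Psi> l)"
    and supp: "l < 2 ^ CARD('n) \<Longrightarrow> norm z > K \<Longrightarrow> \<Psi> l z = 0"
    and K: "K \<ge> 1"
    and M: "l < 2 ^ CARD('n) \<Longrightarrow> \<bar>\<Psi> l z\<bar> \<le> M"
    and mean: "1 \<le> l \<Longrightarrow> l < 2 ^ CARD('n) \<Longrightarrow> (LINT x|lborel. \<Psi> l x) = 0"
    and orth: "w \<in> Omega \<Longrightarrow> w' \<in> Omega \<Longrightarrow>
       (LINT x|lborel. wav \<Psi> w x * wav \<Psi> w' x) = (if w = w' then 1 else 0)"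
    and complete: "g \<in> borel_measurable lborel \<Longrightarrow> integrable lborel (\<lambda>x. (g x)\<^sup>2) \<Longrightarrow>
       (\<And>w. w \<in> Omega \<Longrightarrow> (LINT x|lborel. g x * wav \<Psi> w x) = 0) \<Longrightarrow> AE x in lborel. g x = 0"
begin

definition coef :: "(real^'n \<Rightarrow> real) \<Rightarrow> nat \<times> nat \<times> ('n \<Rightarrow> int) \<Rightarrow> real" where
  "coef f w = (LINT x|lborel. f x * wav \<Psi> w x)"

definition types :: "nat \<Rightarrow> nat set" where
  "types i = {l. l < 2 ^ CARD('n) \<and> (l = 0 \<longrightarrow> i = 0)}"

text \<open>Every translate outside this set has its wavelet of scale i equal to zero at x, which
  keeps \<open>piece\<close> a finite sum although a scale has infinitely many wavelets.\<close>

definition near :: "nat \<Rightarrow> real^'n \<Rightarrow> ('n \<Rightarrow> int) set" where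
  "near i x = {k. norm ((2 ^ i) *\<^sub>R x - intvec k) \<le> K}"

definition piece :: "(real^'n \<Rightarrow> real) \<Rightarrow> nat \<Rightarrow> real^'n \<Rightarrow> real" where
  "piece f i x = (\<Sum>l\<in>types i. \<Sum>k\<in>near i x. coef f (l, i, k) * wav \<Psi> (l, i, k) x)"

text \<open>The power of 2 is |I|^(s/n + 1/2) for a cube I of side 2^(-i), the normalisation used in
  \<open>W0\<close>.\<close>

definition decay :: "real \<Rightarrow> real \<Rightarrow> (real^'n \<Rightarrow> real) \<Rightarrow> bool" where
  "decay C s f \<longleftrightarrow> (\<forall>l i k. (l, i, k) \<in> Omega \<longrightarrow>
      \<bar>coef f (l, i, k)\<bar> \<le> C * 2 powr (- real i * (s + real CARD('n) / 2)))"

definition many :: real where "many = (2 * K + 1) ^ CARD('n)"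

lemma Omega_iff: "(l, i, k :: 'n \<Rightarrow> int) \<in> Omega \<longleftrightarrow> l \<in> types i"
proof -
  have "(1::nat) \<le> 2 ^ CARD('n)" by simp
  then show ?thesis by (auto simp: Omega_def types_def)
qed

lemma typesD: "l \<in> types i \<Longrightarrow> l < 2 ^ CARD('n)"
  by (simp add: types_def)

lemma finite_types: "finite (types i)" and card_types: "card (types i) \<le> 2 ^ CARD('n)"
proof -
  have "types i \<subseteq> {..<2 ^ CARD('n)}" by (auto simp: types_def)
  then show "finite (types i)" "card (types i) \<le> 2 ^ CARD('n)"
    using finite_subset card_mono[of "{..<2 ^ CARD('n)}" "types i"] by auto
qed

lemma M_nonneg: "M \<ge> 0" using M[of 0 0] by (simp add: order_trans[OF abs_ge_zero])

lemma finite_near: "finite (near i x)" and card_near: "real (card (near i x)) \<le> many"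
  using card_intvec_near[of K "(2 ^ i) *\<^sub>R x"] K by (auto simp: near_def many_def)

lemma many_nonneg: "many \<ge> 0" using K by (simp add: many_def)

lemma wav_outside: "l < 2 ^ CARD('n) \<Longrightarrow> k \<notin> near i x \<Longrightarrow> wav \<Psi> (l, i, k) x = 0"
  using supp by (simp add: wav_def near_def)

lemma abs_wav_le: "l < 2 ^ CARD('n) \<Longrightarrow> \<bar>wav \<Psi> (l, i, k) x\<bar> \<le> 2 powr (real i * real CARD('n) / 2) * M"
  using M by (simp add: wav_def abs_mult)

lemma wav_cont: "l < 2 ^ CARD('n) \<Longrightarrow> continuous_on A (wav \<Psi> (l, i, k))"
  unfolding wav_def[abs_def] split_conv
  by (intro continuous_intros continuous_on_compose2[OF cont]) auto

text \<open>Centre of a ball containing the support of the wavelet. With respect to the dyadic cube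
  \<open>dcube i k\<close> it is the lower corner.\<close>

definition center :: "nat \<Rightarrow> ('n \<Rightarrow> int) \<Rightarrow> real^'n" where
  "center i k = (1 / 2 ^ i) *\<^sub>R intvec k"

lemma near_iff: "k \<in> near i x \<longleftrightarrow> x \<in> cball (center i k) (K / 2 ^ i)"
proof -
  have "(2 ^ i) *\<^sub>R x - intvec k = (2 ^ i) *\<^sub>R (x - center i k)"
    by (simp add: center_def scaleR_diff_right)
  then have "norm ((2 ^ i) *\<^sub>R x - intvec k) = 2 ^ i * norm (x - center i k)" by simp
  then show ?thesis by (simp add: near_def dist_norm norm_minus_commute field_simps)
qed

lemma wav_outside_cball: "l < 2 ^ CARD('n) \<Longrightarrow> x \<notin> cball (center i k) (K / 2 ^ i) \<Longrightarrow> wav \<Psi> (l, i, k) x = 0"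
  using wav_outside near_iff by blast

lemma wav_integrable:
  assumes "l < 2 ^ CARD('n)" "continuous_on UNIV f"
  shows "integrable lborel (\<lambda>x. f x * wav \<Psi> (l, i, k) x)"
  by (rule integrable_continuous_bounded_support[of _ "center i k" "K / 2 ^ i"])
     (use assms in \<open>auto intro!: continuous_intros wav_cont simp: wav_outside_cball\<close>)

text \<open>The index set \<open>near i x\<close> moves with x. A common finite superset is what
  allows continuity arguments, differences and integrals of a piece.\<close>

lemma piece_eq:
  assumes "finite S" "near i x \<subseteq> S"
  shows "piece f i x = (\<Sum>l\<in>types i. \<Sum>k\<in>S. coef f (l, i, k) * wav \<Psi> (l, i, k) x)"
  unfolding piece_def
  by (intro sum.cong refl sum.mono_neutral_left) (use assms in \<open>auto simp: wav_outside typesD\<close>)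

lemma powr_geometric: "2 powr (- real i * s) = (2 powr - s) ^ i"
  by (simp add: powr_realpow[symmetric] powr_powr mult.commute)

text \<open>The factor 2^(i n/2) of an L2-normalised wavelet cancels the n/2 in the decay exponent.
  Here y stands for a value or for a difference of the wavelet.\<close>

lemma decay_term_le:
  assumes "\<bar>coef f (l, i, k)\<bar> \<le> C * 2 powr (- real i * (s + real CARD('n) / 2))" and "\<bar>y\<bar> \<le> 2 powr (real i * real CARD('n) / 2) * B"
  shows "\<bar>coef f (l, i, k) * y\<bar> \<le> C * B * (2 powr - s) ^ i"
proof -
  have "\<bar>coef f (l, i, k) * y\<bar> \<le> (C * 2 powr (- real i * (s + real CARD('n) / 2))) * (2 powr (real i * real CARD('n) / 2) * B)"
    unfolding abs_mult using assms abs_ge_zero order_trans by (intro mult_mono) blast+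
  also have "\<dots> = C * B * (2 powr (- real i * (s + real CARD('n) / 2)) * 2 powr (real i * real CARD('n) / 2))"
    by simp
  also have "2 powr (- real i * (s + real CARD('n) / 2)) * 2 powr (real i * real CARD('n) / 2) = 2 powr (- real i * s)"
    by (simp add: powr_add[symmetric] algebra_simps)
  finally show ?thesis by (simp only: powr_geometric)
qed

lemma abs_double_sum_le:
  fixes a :: "nat \<Rightarrow> ('n \<Rightarrow> int) \<Rightarrow> real"
  assumes "\<And>l k. l \<in> types i \<Longrightarrow> k \<in> S \<Longrightarrow> \<bar>a l k\<bar> \<le> B" and "real (card S) \<le> m" and "B \<ge> 0"
  shows "\<bar>\<Sum>l\<in>types i. \<Sum>k\<in>S. a l k\<bar> \<le> 2 ^ CARD('n) * m * B"
proof -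
  have m: "m \<ge> 0" using assms(2) by linarith
  have "\<bar>\<Sum>l\<in>types i. \<Sum>k\<in>S. a l k\<bar> \<le> (\<Sum>l\<in>types i. \<Sum>k\<in>S. \<bar>a l k\<bar>)"
    by (intro order_trans[OF sum_abs] sum_mono sum_abs)
  also have "\<dots> \<le> (\<Sum>l\<in>types i. \<Sum>k\<in>S. B)"
    by (intro sum_mono assms)
  also have "\<dots> = real (card (types i)) * (real (card S) * B)" by simp
  also have "\<dots> \<le> 2 ^ CARD('n) * (m * B)"
  proof (intro mult_mono)
    have "real (card (types i)) \<le> real (2 ^ CARD('n))" using card_types by (rule of_nat_mono)
    then show "real (card (types i)) \<le> 2 ^ CARD('n)" by simp
  qed (use assms m in auto)
  finally show ?thesis by simp
qed

lemma decay_nonneg: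
  assumes "decay C s f" shows "C \<ge> 0"
proof -
  have "(0, 0, undefined :: 'n \<Rightarrow> int) \<in> Omega" by (simp add: Omega_def)
  then have "\<bar>coef f (0, 0, undefined)\<bar> \<le> C * 1" using assms unfolding decay_def by fastforce
  then show ?thesis by linarith
qed

lemma abs_piece_le:
  assumes "decay C s f"
  shows "\<bar>piece f i x\<bar> \<le> 2 ^ CARD('n) * many * (C * M * (2 powr - s) ^ i)"
  unfolding piece_def
proof (rule abs_double_sum_le)
  show "\<bar>coef f (l, i, k) * wav \<Psi> (l, i, k) x\<bar> \<le> C * M * (2 powr - s) ^ i" if "l \<in> types i" for l k
    using assms that by (intro decay_term_le abs_wav_le) (auto simp: decay_def Omega_iff typesD)
qed (use card_near decay_nonneg[OF assms] M_nonneg in auto)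

definition region :: "nat \<Rightarrow> real \<Rightarrow> ('n \<Rightarrow> int) set" where
  "region i \<rho> = {k. norm (intvec k) \<le> 2 ^ i * \<rho> + K}"

lemma finite_region: "\<rho> \<ge> 0 \<Longrightarrow> finite (region i \<rho>)"
  using card_intvec_near(1)[of "2 ^ i * \<rho> + K" 0] K by (simp add: region_def)

lemma near_subset_region: "norm x \<le> \<rho> \<Longrightarrow> near i x \<subseteq> region i \<rho>"
proof
  fix k assume x: "norm x \<le> \<rho>" and "k \<in> near i x"
  then have "norm ((2 ^ i) *\<^sub>R x - intvec k) \<le> K" by (simp add: near_def)
  moreover have "norm (intvec k) \<le> norm ((2 ^ i) *\<^sub>R x) + norm ((2 ^ i) *\<^sub>R x - intvec k)"
    by (metis norm_triangle_sub norm_minus_commute add.commute)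
  moreover have "norm ((2 ^ i) *\<^sub>R x) \<le> 2 ^ i * \<rho>" using x by simp
  ultimately have "norm (intvec k) \<le> 2 ^ i * \<rho> + K" by linarith
  then show "k \<in> region i \<rho>" unfolding region_def by simp
qed

text \<open>Continuity is local, and on a ball the piece is a sum over one fixed finite
  region.\<close>

lemma piece_cont: "continuous_on UNIV (piece f i)"
proof -
  have "continuous (at x) (piece f i)" for x
  proof -
    let ?\<rho> = "norm x + 1"
    have "continuous_on (ball 0 ?\<rho>) (\<lambda>x. \<Sum>l\<in>types i. \<Sum>k\<in>region i ?\<rho>. coef f (l, i, k) * wav \<Psi> (l, i, k) x)"
      by (intro continuous_intros wav_cont) (auto simp: typesD)
    then have "continuous_on (ball 0 ?\<rho>) (piece f i)"
      by (rule continuous_on_cong[OF refl, THEN iffD1, rotated])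
         (auto intro!: piece_eq[symmetric] finite_region near_subset_region)
    then show ?thesis
      by (rule continuous_on_interior) (simp add: dist_norm)
  qed
  then show ?thesis by (simp add: continuous_on_eq_continuous_at)
qed

definition partial :: "(real^'n \<Rightarrow> real) \<Rightarrow> nat \<Rightarrow> real^'n \<Rightarrow> real" where
  "partial f J x = (\<Sum>i<J. piece f i x)"

definition limit :: "(real^'n \<Rightarrow> real) \<Rightarrow> real^'n \<Rightarrow> real" where
  "limit f x = (\<Sum>i. piece f i x)"

lemma partial_cont: "continuous_on UNIV (partial f J)"
  unfolding partial_def[abs_def] by (intro continuous_intros piece_cont)

lemma geometric_lt_1: "s > 0 \<Longrightarrow> 2 powr - s < (1::real)"
  using powr_less_mono[of "-s" 0 2] by simp

lemma summable_decay: "s > 0 \<Longrightarrow> summable (\<lambda>i. 2 ^ CARD('n) * many * (C * M * (2 powr - s) ^ i))"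
  using geometric_lt_1 by (intro summable_mult summable_geometric) auto

lemma uniform_limit_partial:
  assumes "decay C s f" "s > 0"
  shows "uniform_limit UNIV (partial f) (limit f) sequentially"
  unfolding partial_def[abs_def] limit_def[abs_def]
  by (rule Weierstrass_m_test[OF _ summable_decay[OF assms(2)]]) (use abs_piece_le[OF assms(1)] in auto)

lemma limit_cont:
  assumes "decay C s f" "s > 0" shows "continuous_on UNIV (limit f)"
  by (rule uniform_limit_theorem[OF _ uniform_limit_partial[OF assms]]) (auto simp: partial_cont)

lemma sums_limit:
  assumes "decay C s f" "s > 0" shows "(\<lambda>i. piece f i x) sums limit f x"
  unfolding limit_def
  by (rule summable_sums, rule summable_comparison_test'[OF summable_decay[OF assms(2)]])
     (use abs_piece_le[OF assms(1)] in auto)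


text \<open>Subtracting the value of u at the centre costs nothing and gains the radius K/2^i. The
  zero mean is a hypothesis instead of \<open>1 \<le> l\<close> so that the lemma can also be
  applied to the scaling function when its mean is assumed to vanish.\<close>

lemma coef_zero_mean_lipschitz:
  assumes l: "l < 2 ^ CARD('n)" and zero: "(LINT x|lborel. \<Psi> l x) = 0"
    and u: "continuous_on UNIV u" and lip: "\<And>x y. \<bar>u x - u y\<bar> \<le> \<Lambda> * norm (x - y)"
  shows "\<bar>coef u (l, i, k)\<bar>
     \<le> \<Lambda> * (K * M * (unit_ball_vol (real CARD('n)) * K ^ CARD('n))) * 2 powr (- real i * (1 + real CARD('n) / 2))"
proof -
  define a where "a = center i k"
  let ?w = "wav \<Psi> (l, i, k)"
  have L0: "\<Lambda> \<ge> 0"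
  proof -
    obtain h :: "real^'n" where "norm h = 1" using vector_choose_size[of 1] by auto
    with lip[of h 0] show ?thesis by simp
  qed
  have m: "?w \<in> borel_measurable borel"
    using wav_cont[OF l] by (rule borel_measurable_continuous_onI)
  have "(LINT x|lborel. ?w x) = (1 / 2 ^ i) ^ CARD('n) * (LINT x|lborel. ?w (a + (1 / 2 ^ i) *\<^sub>R x))"
    using lborel_integral_affine[OF m, of "1 / 2 ^ i" a] by simp
  also have "(\<lambda>x. ?w (a + (1 / 2 ^ i) *\<^sub>R x)) = (\<lambda>x. 2 powr (real i * real CARD('n) / 2) * \<Psi> l x)"
    by (simp add: wav_def a_def center_def scaleR_add_right)
  finally have w0: "(LINT x|lborel. ?w x) = 0" by (simp add: zero)
  have "coef u (l, i, k) = (LINT x|lborel. u x * ?w x) - (LINT x|lborel. u a * ?w x)"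
    by (simp add: coef_def w0)
  also have "\<dots> = (LINT x|lborel. (u x - u a) * ?w x)"
    unfolding left_diff_distrib by (intro Bochner_Integration.integral_diff[symmetric] wav_integrable l u continuous_on_const)
  finally have e: "coef u (l, i, k) = (LINT x|lborel. (u x - u a) * ?w x)" .
  have b: "\<bar>(u x - u a) * ?w x\<bar> \<le> \<Lambda> * (K / 2 ^ i) * (2 powr (real i * real CARD('n) / 2) * M)"
    if "x \<in> cball a (K / 2 ^ i)" for x
    unfolding abs_mult
  proof (intro mult_mono abs_wav_le l)
    have "\<bar>u x - u a\<bar> \<le> \<Lambda> * norm (x - a)" by (rule lip)
    also have "\<dots> \<le> \<Lambda> * (K / 2 ^ i)"
      using L0 that by (intro mult_left_mono) (auto simp: dist_norm norm_minus_commute)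
    finally show "\<bar>u x - u a\<bar> \<le> \<Lambda> * (K / 2 ^ i)" .
  qed (use L0 K in auto)
  have "\<bar>coef u (l, i, k)\<bar> \<le> \<Lambda> * (K / 2 ^ i) * (2 powr (real i * real CARD('n) / 2) * M) *
      (unit_ball_vol (real CARD('n)) * (K / 2 ^ i) ^ CARD('n))"
    unfolding e using abs_integral_le_cball[of a "K / 2 ^ i" "\<lambda>x. (u x - u a) * ?w x", OF b] K l
    by (simp add: wav_outside_cball a_def)
  also have "\<dots> = \<Lambda> * (K * M * (unit_ball_vol (real CARD('n)) * K ^ CARD('n))) *
      (2 powr (real i * real CARD('n) / 2) * (1 / 2 ^ i) * (1 / 2 ^ i) ^ CARD('n))"
    by (simp add: power_divide)
  also have "2 powr (real i * real CARD('n) / 2) * (1 / 2 ^ i) * (1 / 2 ^ i) ^ CARD('n)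
      = 2 powr (- real i * (1 + real CARD('n) / 2))"
  proof -
    have p: "(1 / 2 ^ i :: real) = 2 powr (- real i)" by (simp add: powr_minus powr_realpow divide_inverse)
    have "(2 powr (- real i)) ^ CARD('n) = 2 powr (- real i * real CARD('n))"
      by (simp add: powr_realpow[symmetric] powr_powr)
    moreover have "real i * real CARD('n) / 2 + - real i + - real i * real CARD('n) = - real i * (1 + real CARD('n) / 2)"
      by (simp add: algebra_simps)
    ultimately show ?thesis unfolding p by (simp only: powr_add[symmetric])
  qed
  finally show ?thesis .
qed

lemma abs_coef_coarse_le:
  assumes l: "l < 2 ^ CARD('n)" and B: "\<And>x. \<bar>u x\<bar> \<le> B"
  shows "\<bar>coef u (l, 0, k)\<bar> \<le> B * M * (unit_ball_vol (real CARD('n)) * K ^ CARD('n))"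
proof -
  have "\<bar>u x * wav \<Psi> (l, 0, k) x\<bar> \<le> B * M" for x
    unfolding abs_mult using abs_wav_le[OF l, of 0 k x] B[of x] by (intro mult_mono) auto
  then show ?thesis
    unfolding coef_def
    using abs_integral_le_cball[of "center 0 k" K "\<lambda>x. u x * wav \<Psi> (l, 0, k) x" "B * M"] K wav_outside_cball[OF l, of _ 0 k]
    by simp
qed

text \<open>Exponent 1 from the zero mean of the types l >= 1; type 0 occurs only at scale 0, where
  a bound without any decay suffices.\<close>

lemma lipschitz_decay:
  assumes u: "continuous_on UNIV u" and lip: "\<And>x y. \<bar>u x - u y\<bar> \<le> \<Lambda> * norm (x - y)"
    and B: "\<And>x. \<bar>u x\<bar> \<le> B"
  shows "\<exists>C. decay C 1 u"
proof -
  let ?V = "unit_ball_vol (real CARD('n)) * K ^ CARD('n)"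
  have "\<bar>coef u (l, i, k)\<bar> \<le> max (\<Lambda> * (K * M * ?V)) (B * M * ?V) * 2 powr (- real i * (1 + real CARD('n) / 2))"
    if "l \<in> types i" for l i k
  proof (cases "l = 0")
    case True
    then have "i = 0" using that by (simp add: types_def)
    then show ?thesis using abs_coef_coarse_le[of l u B k] B typesD[OF that] by simp
  next
    case False
    have "\<bar>coef u (l, i, k)\<bar> \<le> \<Lambda> * (K * M * ?V) * 2 powr (- real i * (1 + real CARD('n) / 2))"
      using False typesD[OF that] by (intro coef_zero_mean_lipschitz mean u lip) auto
    also have "\<dots> \<le> max (\<Lambda> * (K * M * ?V)) (B * M * ?V) * 2 powr (- real i * (1 + real CARD('n) / 2))"
      by (intro mult_right_mono) auto
    finally show ?thesis .
  qed
  then show ?thesis unfolding decay_def Omega_iff by blast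
qed

lemma integral_wavelet_sum:
  assumes "continuous_on UNIV f"
  shows "(LINT x|lborel. (\<Sum>i<J. \<Sum>l\<in>types i. \<Sum>k\<in>S i. c l i k * (f x * wav \<Psi> (l, i, k) x)))
     = (\<Sum>i<J. \<Sum>l\<in>types i. \<Sum>k\<in>S i. c l i k * coef f (l, i, k))"
proof -
  have i0: "integrable lborel (\<lambda>x. c l i k * (f x * wav \<Psi> (l, i, k) x))" if "l \<in> types i" for l i k
    using wav_integrable[OF typesD[OF that] assms] by simp
  have i1: "integrable lborel (\<lambda>x. \<Sum>k\<in>S i. c l i k * (f x * wav \<Psi> (l, i, k) x))" if "l \<in> types i" for l i
    by (intro Bochner_Integration.integrable_sum i0 that)
  have i2: "integrable lborel (\<lambda>x. \<Sum>l\<in>types i. \<Sum>k\<in>S i. c l i k * (f x * wav \<Psi> (l, i, k) x))" for i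
    by (intro Bochner_Integration.integrable_sum i1)
  have "(LINT x|lborel. (\<Sum>i<J. \<Sum>l\<in>types i. \<Sum>k\<in>S i. c l i k * (f x * wav \<Psi> (l, i, k) x)))
      = (\<Sum>i<J. (LINT x|lborel. (\<Sum>l\<in>types i. \<Sum>k\<in>S i. c l i k * (f x * wav \<Psi> (l, i, k) x))))"
    by (rule Bochner_Integration.integral_sum) (rule i2)
  also have "\<dots> = (\<Sum>i<J. \<Sum>l\<in>types i. (LINT x|lborel. (\<Sum>k\<in>S i. c l i k * (f x * wav \<Psi> (l, i, k) x))))"
    by (intro sum.cong refl Bochner_Integration.integral_sum i1)
  also have "\<dots> = (\<Sum>i<J. \<Sum>l\<in>types i. \<Sum>k\<in>S i. (LINT x|lborel. c l i k * (f x * wav \<Psi> (l, i, k) x)))"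
    by (intro sum.cong refl Bochner_Integration.integral_sum i0)
  finally show ?thesis by (simp add: coef_def)
qed

section \<open>Duality with functions of compact support\<close>

context
  fixes u :: "real^'n \<Rightarrow> real" and \<rho> :: real
  assumes u: "continuous_on UNIV u" and us: "\<And>x. norm x > \<rho> \<Longrightarrow> u x = 0" and \<rho>: "\<rho> > 0"
begin

lemma coef_outside_region:
  assumes "l < 2 ^ CARD('n)" "k \<notin> region i \<rho>"
  shows "coef u (l, i, k) = 0"
proof -
  have "u x * wav \<Psi> (l, i, k) x = 0" for x
  proof (cases "norm x \<le> \<rho>")
    case True
    then have "k \<notin> near i x" using near_subset_region assms(2) by blast
    then show ?thesis using wav_outside assms(1) by simp
  next
    case False
    then show ?thesis using us by simp
  qed
  then show ?thesis unfolding coef_def by (simp only: Bochner_Integration.integral_zero)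
qed

lemma piece_bounded_support:
  "piece u i x = (\<Sum>l\<in>types i. \<Sum>k\<in>region i \<rho>. coef u (l, i, k) * wav \<Psi> (l, i, k) x)"
proof -
  have fin: "finite (region i \<rho> \<union> near i x)" using finite_region finite_near \<rho> by simp
  have "piece u i x = (\<Sum>l\<in>types i. \<Sum>k\<in>region i \<rho> \<union> near i x. coef u (l, i, k) * wav \<Psi> (l, i, k) x)"
    by (rule piece_eq[OF fin]) simp
  also have "\<dots> = (\<Sum>l\<in>types i. \<Sum>k\<in>region i \<rho>. coef u (l, i, k) * wav \<Psi> (l, i, k) x)"
    by (intro sum.cong refl sum.mono_neutral_right) (use fin in \<open>auto simp: coef_outside_region typesD\<close>)
  finally show ?thesis .
qed

text \<open>The radius is the same for all scales because 2^i >= 1; passing to the limit under the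
  integral needs one ball for all partial sums.\<close>

lemma piece_outside: "norm x > \<rho> + 2 * K \<Longrightarrow> piece u i x = 0"
proof -
  assume x: "norm x > \<rho> + 2 * K"
  have "k \<notin> near i x" if k: "k \<in> region i \<rho>" for k
  proof
    assume "k \<in> near i x"
    then have "norm ((2 ^ i) *\<^sub>R x - intvec k) \<le> K" by (simp add: near_def)
    moreover have "norm ((2 ^ i) *\<^sub>R x) \<le> norm (intvec k) + norm ((2 ^ i) *\<^sub>R x - intvec k)"
      by (metis norm_triangle_sub)
    ultimately have "2 ^ i * norm x \<le> 2 ^ i * \<rho> + 2 * K" using k by (simp add: region_def)
    also have "\<dots> \<le> 2 ^ i * \<rho> + 2 ^ i * (2 * K)" using K by simp
    also have "\<dots> = 2 ^ i * (\<rho> + 2 * K)" by (simp add: algebra_simps)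
    finally show False using x by simp
  qed
  then show ?thesis unfolding piece_bounded_support
    by (intro sum.neutral ballI) (auto simp: wav_outside typesD)
qed

lemma integral_partial_bounded_support:
  assumes "continuous_on UNIV f"
  shows "(LINT x|lborel. partial u J x * f x)
     = (\<Sum>i<J. \<Sum>l\<in>types i. \<Sum>k\<in>region i \<rho>. coef u (l, i, k) * coef f (l, i, k))"
proof -
  have "partial u J x * f x
      = (\<Sum>i<J. \<Sum>l\<in>types i. \<Sum>k\<in>region i \<rho>. coef u (l, i, k) * (f x * wav \<Psi> (l, i, k) x))" for x
    unfolding partial_def piece_bounded_support by (simp add: sum_distrib_right sum_distrib_left mult_ac)
  then show ?thesis using integral_wavelet_sum[OF assms] by simp
qed

text \<open>The right-hand side is that of \<open>integral_partial_bounded_support\<close> and is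
  symmetric in u and f. This symmetry carries the expansion from u to f.\<close>

lemma integral_partial_times:
  "(LINT x|lborel. partial f J x * u x)
     = (\<Sum>i<J. \<Sum>l\<in>types i. \<Sum>k\<in>region i \<rho>. coef u (l, i, k) * coef f (l, i, k))"
proof -
  have "partial f J x * u x = (\<Sum>i<J. \<Sum>l\<in>types i. \<Sum>k\<in>region i \<rho>. coef f (l, i, k) * (u x * wav \<Psi> (l, i, k) x))" for x
  proof (cases "norm x \<le> \<rho>")
    case True
    have "piece f i x = (\<Sum>l\<in>types i. \<Sum>k\<in>region i \<rho>. coef f (l, i, k) * wav \<Psi> (l, i, k) x)" for i
      using True \<rho> by (intro piece_eq finite_region near_subset_region) auto
    then show ?thesis unfolding partial_def by (simp add: sum_distrib_right sum_distrib_left mult_ac)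
  next
    case False
    then show ?thesis using us by simp
  qed
  then show ?thesis using integral_wavelet_sum[OF u] by (simp add: mult.commute)
qed

lemma coef_partial_bounded_support:
  assumes w: "(l, i, k) \<in> Omega" and "i < J"
  shows "coef (partial u J) (l, i, k) = coef u (l, i, k)"
proof -
  have l: "l \<in> types i" using w by (simp add: Omega_iff)
  have fr: "finite (region i' \<rho>)" for i' using finite_region \<rho> by simp
  have c: "coef (wav \<Psi> (l, i, k)) (l', i', k') = (if (l', i', k') = (l, i, k) then 1 else 0)"
    if "l' \<in> types i'" for l' i' k'
    unfolding coef_def using orth[OF w, of "(l', i', k')"] that by (auto simp: Omega_iff)
  have "coef (partial u J) (l, i, k) = (LINT x|lborel. partial u J x * wav \<Psi> (l, i, k) x)"
    by (simp add: coef_def)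
  also have "\<dots> = (\<Sum>i'<J. \<Sum>l'\<in>types i'. \<Sum>k'\<in>region i' \<rho>. coef u (l', i', k') * coef (wav \<Psi> (l, i, k)) (l', i', k'))"
    by (rule integral_partial_bounded_support) (rule wav_cont[OF typesD[OF l]])
  also have "\<dots> = (\<Sum>i'<J. if i' = i then coef u (l, i, k) else 0)"
  proof (intro sum.cong refl)
    fix i'
    have "(\<Sum>k'\<in>region i' \<rho>. coef u (l', i', k') * coef (wav \<Psi> (l, i, k)) (l', i', k'))
        = (if l' = l \<and> i' = i then coef u (l, i, k) else 0)" if l': "l' \<in> types i'" for l'
    proof -
      have "(\<Sum>k'\<in>region i' \<rho>. coef u (l', i', k') * coef (wav \<Psi> (l, i, k)) (l', i', k'))
          = (\<Sum>k'\<in>region i' \<rho>. if k' = k then (if l' = l \<and> i' = i then coef u (l, i, k) else 0) else 0)"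
        by (intro sum.cong refl) (auto simp: c[OF l'])
      also have "\<dots> = (if k \<in> region i' \<rho> then (if l' = l \<and> i' = i then coef u (l, i, k) else 0) else 0)"
        using fr by (simp add: sum.delta)
      \<comment> \<open>If k lies outside the region, the coefficient of u is zero anyway.\<close>
      also have "\<dots> = (if l' = l \<and> i' = i then coef u (l, i, k) else 0)"
        using coef_outside_region[OF typesD[OF l], of k] by auto
      finally show ?thesis .
    qed
    then have "(\<Sum>l'\<in>types i'. \<Sum>k'\<in>region i' \<rho>. coef u (l', i', k') * coef (wav \<Psi> (l, i, k)) (l', i', k'))
        = (\<Sum>l'\<in>types i'. if l' = l then (if i' = i then coef u (l, i, k) else 0) else 0)"
      by (intro sum.cong refl) auto
    also have "\<dots> = (if i' = i then coef u (l, i, k) else 0)"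
      using l finite_types by (auto simp: sum.delta)
    finally show "(\<Sum>l'\<in>types i'. \<Sum>k'\<in>region i' \<rho>. coef u (l', i', k') * coef (wav \<Psi> (l, i, k)) (l', i', k'))
        = (if i' = i then coef u (l, i, k) else 0)" .
  qed
  also have "\<dots> = coef u (l, i, k)" using assms(2) by (simp add: sum.delta)
  finally show ?thesis .
qed

lemma limit_outside: "norm x > \<rho> + 2 * K \<Longrightarrow> limit u x = 0"
  by (simp add: limit_def piece_outside)

text \<open>The difference of u and its series is continuous with compact support, hence square
  integrable, and orthogonality makes all its coefficients vanish. Thus completeness
  applies.\<close>

lemma AE_eq_limit:
  assumes "decay C s u" "s > 0"
  shows "AE x in lborel. u x = limit u x"
proof -
  note ul = uniform_limit_partial[OF assms] and cl = limit_cont[OF assms]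
  define g where "g x = u x - limit u x" for x
  have cg: "continuous_on UNIV g" unfolding g_def by (intro continuous_intros u cl)
  have g0: "g x = 0" if "x \<notin> cball 0 (\<rho> + 2 * K)" for x
    using that us[of x] limit_outside[of x] K by (simp add: g_def)
  have "AE x in lborel. g x = 0"
  proof (rule complete)
    show "g \<in> borel_measurable lborel" using borel_measurable_continuous_onI[OF cg] by simp
    show "integrable lborel (\<lambda>x. (g x)\<^sup>2)"
      by (rule integrable_continuous_bounded_support[of _ 0 "\<rho> + 2 * K"])
         (use g0 in \<open>auto intro!: continuous_intros cg\<close>)
    fix w :: "nat \<times> nat \<times> ('n \<Rightarrow> int)" assume w: "w \<in> Omega"
    obtain l i k where weq: "w = (l, i, k)" by (cases w)
    have l: "l < 2 ^ CARD('n)" using w by (simp add: weq Omega_iff typesD)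
    have "(\<lambda>J. LINT x|lborel. partial u J x * wav \<Psi> w x) \<longlonglongrightarrow> (LINT x|lborel. limit u x * wav \<Psi> w x)"
      unfolding weq
      by (rule integral_uniform_limit[OF ul partial_cont wav_cont[OF l] _ _ abs_wav_le[OF l], where a="center i k" and R="K / 2 ^ i"])
         (use K l in \<open>auto simp: wav_outside_cball\<close>)
    moreover have "(\<lambda>J. LINT x|lborel. partial u J x * wav \<Psi> w x) \<longlonglongrightarrow> coef u w"
    proof (rule tendsto_eventually)
      show "\<forall>\<^sub>F J in sequentially. (LINT x|lborel. partial u J x * wav \<Psi> w x) = coef u w"
        using eventually_gt_at_top[of i]
      proof eventually_elim
        case (elim J)
        then show ?case using coef_partial_bounded_support[of l i k J] w by (simp add: weq coef_def)
      qed
    qed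
    ultimately have "(LINT x|lborel. limit u x * wav \<Psi> w x) = coef u w" by (rule LIMSEQ_unique)
    then show "(LINT x|lborel. g x * wav \<Psi> w x) = 0"
      unfolding g_def left_diff_distrib weq
      using wav_integrable[OF l u, of i k] wav_integrable[OF l cl, of i k] by (simp add: coef_def)
  qed
  then show ?thesis by (simp add: g_def)
qed

text \<open>The integrals of \<open>partial f J\<close> against u and of \<open>partial u J\<close>
  against f agree for every J; their limits are the integrals of \<open>limit f\<close> against u
  and of u against f.\<close>

lemma integral_limit_times:
  assumes "decay C s u" "s > 0" and "decay C' s' f" "s' > 0" and f: "continuous_on UNIV f" and B: "\<And>x. \<bar>f x\<bar> \<le> B"
  shows "(LINT x|lborel. limit f x * u x) = (LINT x|lborel. f x * u x)"
proof -
  have "(LINT x|lborel. f x * u x) = (LINT x|lborel. limit u x * f x)"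
    using AE_eq_limit[OF assms(1,2)] borel_measurable_continuous_onI[OF u] borel_measurable_continuous_onI[OF f]
      borel_measurable_continuous_onI[OF limit_cont[OF assms(1,2)]]
    by (intro integral_cong_AE) (auto elim: eventually_mono)
  moreover have "(\<lambda>J. LINT x|lborel. partial u J x * f x) \<longlonglongrightarrow> (LINT x|lborel. limit u x * f x)"
    by (rule integral_uniform_limit[OF uniform_limit_partial[OF assms(1,2)] partial_cont f _ _ B, where a=0 and R="\<rho> + 2 * K"])
       (use K \<rho> in \<open>auto simp: limit_outside partial_def piece_outside\<close>)
  moreover obtain Bu where "\<And>x. \<bar>u x\<bar> \<le> Bu"
  proof -
    have "bounded {x. u x \<noteq> 0}"
      by (rule bounded_subset[OF bounded_cball[of 0 \<rho>]]) (use us in force)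
    then show thesis using continuous_bounded_support_bounded[OF u] that by auto
  qed
  then have "(\<lambda>J. LINT x|lborel. partial f J x * u x) \<longlonglongrightarrow> (LINT x|lborel. limit f x * u x)"
    by (intro integral_uniform_limit[OF uniform_limit_partial[OF assms(3,4)] partial_cont u, where a=0 and R=\<rho>])
       (use us \<rho> in auto)
  ultimately show ?thesis
    unfolding integral_partial_times integral_partial_bounded_support[OF f]
    by (simp only: LIMSEQ_unique)
qed

end

text \<open>Cones have decay of exponent 1, so duality makes f and its series indistinguishable by
  cones. Both are continuous, hence they agree at every point, not merely almost everywhere.\<close>

theorem wavelet_expansion:
  assumes "decay C s f" "s > 0" and f: "continuous_on UNIV f" and B: "\<And>x. \<bar>f x\<bar> \<le> B"
  shows "(\<lambda>i. piece f i x) sums f x"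
proof -
  have "f x - limit f x = 0"
  proof (rule eq_0_if_orthogonal_to_cones[of "\<lambda>x. f x - limit f x"])
    show "continuous_on UNIV (\<lambda>x. f x - limit f x)"
      by (intro continuous_intros f limit_cont[OF assms(1,2)])
    fix x0 :: "real^'n" and \<rho> :: real assume \<rho>: "\<rho> > 0"
    define u where "u x = max 0 (\<rho> - dist x x0)" for x
    have cu: "continuous_on UNIV u" unfolding u_def by (intro continuous_intros)
    have lip: "\<bar>u x - u y\<bar> \<le> 1 * norm (x - y)" for x y
      using dist_triangle[of x x0 y] dist_triangle[of y x0 x] by (simp add: u_def dist_norm norm_minus_commute)
    have bu: "\<bar>u x\<bar> \<le> \<rho>" for x using \<rho> by (simp add: u_def)
    obtain Cu where du: "decay Cu 1 u" using lipschitz_decay[OF cu lip bu] by blast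
    have us: "u x = 0" if "norm x > norm x0 + \<rho>" for x
      using that norm_triangle_sub[of x x0] by (simp add: u_def dist_norm)
    have "(LINT x|lborel. limit f x * u x) = (LINT x|lborel. f x * u x)"
      by (rule integral_limit_times[where \<rho>="norm x0 + \<rho>", OF cu us _ du _ assms(1,2) f B]) (use \<rho> in \<open>auto intro: add_nonneg_pos\<close>)
    moreover have "integrable lborel (\<lambda>x. h x * u x)" if "continuous_on UNIV h" for h
      by (rule integrable_continuous_bounded_support[of _ 0 "norm x0 + \<rho>"])
         (use us that in \<open>auto intro!: continuous_intros cu\<close>)
    ultimately have "(LINT x|lborel. (f x - limit f x) * u x) = 0"
      unfolding left_diff_distrib using f limit_cont[OF assms(1,2)] by simp
    then show "(LINT x|lborel. (f x - limit f x) * max 0 (\<rho> - dist x x0)) = 0" unfolding u_def .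
  qed
  then show ?thesis using sums_limit[OF assms(1,2), of x] by simp
qed

lemma scaling_function_mean: "(LINT x|lborel. \<Psi> 0 x) \<noteq> 0"
proof
  assume zero: "(LINT x|lborel. \<Psi> 0 x) = 0"
  define c0 where "c0 = K * M * (unit_ball_vol (real CARD('n)) * K ^ CARD('n))"
  have c0: "c0 \<ge> 0" using K M_nonneg by (simp add: c0_def)
  \<comment> \<open>A cone of width \<open>\<rho>\<close> has slope \<open>1/\<rho>\<close>, so its series would be \<open>O(1/\<rho>)\<close> at the apex.\<close>
  define Q where "Q = 2 ^ CARD('n) * many * (c0 * M)"
  have Q: "Q \<ge> 0" using c0 M_nonneg many_nonneg by (simp add: Q_def)
  \<comment> \<open>The piece of scale i at the apex is at most (Q/\<rho>) 2^(-i), so the series is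
    at most 2 Q/\<rho> < 1, whereas \<open>u 0 = 1\<close>.\<close>
  define \<rho> where "\<rho> = 2 * Q + 1"
  have \<rho>: "\<rho> > 0" using Q by (simp add: \<rho>_def)
  define u :: "real^'n \<Rightarrow> real" where "u x = max 0 (1 - norm x / \<rho>)" for x
  have cu: "continuous_on UNIV u" unfolding u_def by (intro continuous_intros) (use \<rho> in auto)
  have lip: "\<bar>u x - u y\<bar> \<le> (1 / \<rho>) * norm (x - y)" for x y
  proof -
    have "\<bar>u x - u y\<bar> \<le> \<bar>norm x / \<rho> - norm y / \<rho>\<bar>" unfolding u_def by linarith
    also have "\<dots> = \<bar>norm x - norm y\<bar> / \<rho>" using \<rho> by (simp add: diff_divide_distrib[symmetric])
    also have "\<dots> \<le> norm (x - y) / \<rho>" using \<rho> by (intro divide_right_mono norm_triangle_ineq3) auto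
    finally show ?thesis by simp
  qed
  have bu: "\<bar>u x\<bar> \<le> 1" for x using \<rho> by (simp add: u_def)
  have "\<bar>coef u (l, i, k)\<bar> \<le> 1 / \<rho> * c0 * 2 powr (- real i * (1 + real CARD('n) / 2))" if "l \<in> types i" for l i k
    unfolding c0_def using zero mean[of l] typesD[OF that]
    by (intro coef_zero_mean_lipschitz cu lip) (cases "l = 0"; auto)+
  then have d: "decay (c0 / \<rho>) 1 u" unfolding decay_def Omega_iff by simp
  have s1: "(\<lambda>i. piece u i 0) sums u 0" by (rule wavelet_expansion[OF d _ cu bu]) simp
  have s2: "(\<lambda>i. Q / \<rho> * (1/2) ^ i) sums (Q / \<rho> * 2)"
    using sums_mult[OF geometric_sums[of "1/2::real"], of "Q / \<rho>"] by simp
  have le: "piece u i 0 \<le> Q / \<rho> * (1/2) ^ i" for i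
  proof -
    have "(2 powr - 1 :: real) = 1/2" by (simp add: powr_minus_divide)
    moreover have "piece u i 0 \<le> 2 ^ CARD('n) * many * (c0 / \<rho> * M * (2 powr - 1) ^ i)"
      using abs_piece_le[OF d, of i 0] by linarith
    ultimately show ?thesis by (simp add: Q_def)
  qed
  have "u 0 \<le> Q / \<rho> * 2" by (rule sums_le[OF le s1 s2])
  moreover have "Q / \<rho> * 2 < 1" using Q by (simp add: \<rho>_def)
  ultimately show False by (simp add: u_def)
qed

end

section \<open>Differences of wavelet series\<close>

lemma Ck_Suc_imp_Ck: "Ck (Suc k) g \<Longrightarrow> Ck k g"
proof (induction k arbitrary: g)
  case 0
  then obtain D where "\<And>x. (g has_derivative D x) (at x)" by auto
  then show ?case
    by (auto simp: continuous_on_eq_continuous_at intro: has_derivative_continuous)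
next
  case (Suc k)
  then obtain D where D: "\<And>x. (g has_derivative D x) (at x)" "\<And>i. Ck (Suc k) (\<lambda>x. D x (axis i 1))"
    by (auto simp only: Ck.simps)
  then show ?case using Suc.IH by (auto intro!: exI[of _ D])
qed

lemma Ck_le: "Ck k g \<Longrightarrow> m \<le> k \<Longrightarrow> Ck m g"
  by (induction k) (auto simp: le_Suc_eq simp del: Ck.simps dest: Ck_Suc_imp_Ck)

lemma poly_lt_moment_zero:
  fixes g :: "real^'n \<Rightarrow> real"
  assumes g: "continuous_on UNIV g" "\<And>x. norm x > K \<Longrightarrow> g x = 0"
    and mom: "\<And>\<alpha>::'n \<Rightarrow> nat. sum \<alpha> UNIV \<le> L \<Longrightarrow> (LINT x|lborel. monomial \<alpha> x * g x) = 0"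
    and p: "poly_lt N p" and "N \<le> Suc L"
  shows "(LINT x|lborel. p x * g x) = 0"
proof -
  have i: "integrable lborel (\<lambda>x. q x * g x)" if "poly_lt N q" for q
    by (rule integrable_continuous_bounded_support[of _ 0 K])
       (use g in \<open>auto intro!: continuous_intros poly_lt_continuous[OF that]\<close>)
  show ?thesis using p
  proof (induction rule: poly_lt.induct)
    case (mono \<alpha>)
    then show ?case using assms(5) by (intro mom) simp
  next
    case (add p q)
    then show ?case using i[OF add(1)] i[OF add(2)] by (simp add: distrib_right)
  next
    case (scale p c)
    then show ?case by (simp add: mult.assoc)
  qed simp
qed

text \<open>Used when only p of the r differences can be paid for by derivatives; each remaining one
  costs a factor 2.\<close>

lemma abs_diffk_add_le:
  assumes "\<And>x. \<bar>diffk p h f x\<bar> \<le> B"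
  shows "\<bar>diffk (p + q) h f x\<bar> \<le> 2 ^ q * B"
proof (induction q arbitrary: x)
  case 0
  then show ?case using assms by simp
next
  case (Suc q)
  have "\<bar>diffk (p + Suc q) h f x\<bar> \<le> 2 * (2 ^ q * B)"
    unfolding add_Suc_right diffk_Suc_commute
    using Suc.IH[of "x + (1/2) *\<^sub>R h"] Suc.IH[of "x - (1/2) *\<^sub>R h"] by linarith
  then show ?case by simp
qed

text \<open>Increasing j by one shifts the series by one index and puts \<gamma>^(j+1) in
  front.\<close>

lemma two_sided_geometric_sums:
  fixes \<gamma> :: real
  assumes "0 < \<gamma>" "\<gamma> < 1"
  shows "(\<lambda>i. \<gamma> ^ nat \<bar>int i - int j\<bar>) sums (1 / (1 - \<gamma>) + (\<Sum>d<j. \<gamma> ^ Suc d))"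
proof (induction j)
  case 0
  then show ?case using geometric_sums[of \<gamma>] assms by simp
next
  case (Suc j)
  have "(\<lambda>i. \<gamma> ^ nat \<bar>int (Suc i) - int (Suc j)\<bar>) sums (1 / (1 - \<gamma>) + (\<Sum>d<j. \<gamma> ^ Suc d))"
    using Suc by simp
  from sums_Suc[OF this] show ?case by (simp add: add.assoc nat_add_distrib)
qed

lemma two_sided_geometric_le:
  fixes \<gamma> :: real
  assumes "0 < \<gamma>" "\<gamma> < 1"
  shows "1 / (1 - \<gamma>) + (\<Sum>d<j. \<gamma> ^ Suc d) \<le> 2 / (1 - \<gamma>)"
proof -
  have "(\<Sum>d<j. \<gamma> ^ Suc d) \<le> (\<Sum>d<j. \<gamma> ^ d)"
    using assms by (intro sum_mono power_decreasing) auto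
  also have "\<dots> \<le> (\<Sum>d. \<gamma> ^ d)"
    using assms by (intro sum_le_suminf summable_geometric) auto
  also have "\<dots> = 1 / (1 - \<gamma>)" using assms by (simp add: suminf_geometric)
  finally show ?thesis by simp
qed

text \<open>For i >= j the entry 1 of the minimum leaves 2^(-is), decaying at rate s away from j.
  For i < j the p-th power gives 2^(-js) with decay at rate p - s.\<close>

lemma scale_balance:
  fixes s \<tau> y :: real
  assumes "\<tau> \<le> s" "\<tau> \<le> real p - s" "0 \<le> y" "y \<le> 2 powr - real j"
  shows "(2 powr - s) ^ i * min 1 ((2 ^ i * y) ^ p) \<le> 2 powr (- real j * s) * (2 powr - \<tau>) ^ nat \<bar>int i - int j\<bar>"
proof -
  have pw: "(2 powr a) ^ d = 2 powr (a * real d)" for a d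
    by (simp add: powr_realpow[symmetric] powr_powr)
  show ?thesis
  proof (cases "j \<le> i")
    case True
    have "(2 powr - s) ^ i * min 1 ((2 ^ i * y) ^ p) \<le> (2 powr - s) ^ i * 1"
      by (intro mult_left_mono) auto
    also have "\<dots> \<le> 2 powr (- real j * s + - \<tau> * (real i - real j))"
    proof -
      have "\<tau> * (real i - real j) \<le> s * (real i - real j)" using True assms by (intro mult_right_mono) auto
      then show ?thesis unfolding pw mult_1_right by (intro powr_mono) (auto simp: algebra_simps)
    qed
    also have "\<dots> = 2 powr (- real j * s) * (2 powr - \<tau>) ^ nat \<bar>int i - int j\<bar>"
      using True unfolding pw powr_add by (simp add: of_nat_diff)
    finally show ?thesis .
  next
    case False
    have "2 ^ i * y \<le> 2 powr (real i - real j)"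
      using assms by (simp add: powr_diff powr_realpow powr_minus field_simps)
    then have "(2 ^ i * y) ^ p \<le> 2 powr ((real i - real j) * real p)"
      unfolding pw[symmetric] using assms by (intro power_mono) auto
    then have "(2 powr - s) ^ i * min 1 ((2 ^ i * y) ^ p) \<le> (2 powr - s) ^ i * 2 powr ((real i - real j) * real p)"
      by (intro mult_left_mono) auto
    also have "\<dots> = 2 powr (- s * real i + (real i - real j) * real p)"
      unfolding pw powr_add ..
    also have "\<dots> \<le> 2 powr (- real j * s + - \<tau> * (real j - real i))"
    proof -
      have "\<tau> * (real j - real i) \<le> (real p - s) * (real j - real i)"
        using False assms by (intro mult_right_mono) auto
      then show ?thesis by (intro powr_mono) (auto simp: algebra_simps)
    qed
    also have "\<dots> = 2 powr (- real j * s) * (2 powr - \<tau>) ^ nat \<bar>int i - int j\<bar>"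
      using False unfolding pw powr_add by (simp add: of_nat_diff)
    finally show ?thesis .
  qed
qed

lemma arcosh_real_mono: "1 \<le> a \<Longrightarrow> a \<le> b \<Longrightarrow> arcosh a \<le> arcosh (b::real)"
  by (metis arcosh_real_strict_mono order_le_less)

text \<open>Heights comparable up to b allow the horizontal distance to be bounded by a multiple of
  y and by a multiple of \<sigma>. The product of the two bounds matches the denominator 2 y
  \<sigma>, leaving a constant free of scale.\<close>

lemma hrho_le:
  fixes x z :: "real^'n"
  assumes y: "y > 0" and \<sigma>: "\<sigma> > 0" and b: "y \<le> b * \<sigma>" "\<sigma> \<le> b * y"
    and d: "norm (x - z) \<le> r * y + K * \<sigma>" and "r \<ge> 0" "K \<ge> 0"
  shows "hrho (x, y) (z, \<sigma>) \<le> arcosh (1 + ((r + K * b) * (r * b + K) + (1 + b)\<^sup>2) / 2)"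
proof -
  have "(norm (x - z))\<^sup>2 \<le> (r * y + K * \<sigma>) * (r * y + K * \<sigma>)"
    unfolding power2_eq_square using d by (intro mult_mono) (auto intro: order_trans[OF norm_ge_zero])
  also have "\<dots> \<le> ((r + K * b) * y) * ((r * b + K) * \<sigma>)"
  proof (rule mult_mono)
    have "K * \<sigma> \<le> K * (b * y)" "r * y \<le> r * (b * \<sigma>)" using assms by (auto intro: mult_left_mono)
    then show "r * y + K * \<sigma> \<le> (r + K * b) * y" "r * y + K * \<sigma> \<le> (r * b + K) * \<sigma>"
      by (auto simp: algebra_simps)
    then show "0 \<le> (r + K * b) * y" using assms by (smt (verit) mult_nonneg_nonneg)
  qed (use assms in auto)
  finally have 1: "(norm (x - z))\<^sup>2 \<le> (r + K * b) * (r * b + K) * (y * \<sigma>)" by (simp add: mult_ac)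
  have "(y - \<sigma>)\<^sup>2 = \<bar>y - \<sigma>\<bar> * \<bar>y - \<sigma>\<bar>" by (simp add: power2_eq_square)
  also have "\<dots> \<le> ((1 + b) * y) * ((1 + b) * \<sigma>)"
    using assms by (intro mult_mono) (auto simp: algebra_simps)
  finally have 2: "(y - \<sigma>)\<^sup>2 \<le> (1 + b)\<^sup>2 * (y * \<sigma>)" by (simp add: power2_eq_square mult_ac)
  have "((norm (x - z))\<^sup>2 + (y - \<sigma>)\<^sup>2) / (2 * y * \<sigma>)
      \<le> (((r + K * b) * (r * b + K) + (1 + b)\<^sup>2) * (y * \<sigma>)) / (2 * y * \<sigma>)"
    using 1 2 y \<sigma> by (intro divide_right_mono) (auto simp: algebra_simps)
  also have "\<dots> = ((r + K * b) * (r * b + K) + (1 + b)\<^sup>2) / 2"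
    using y \<sigma> by simp
  finally have le: "((norm (x - z))\<^sup>2 + (y - \<sigma>)\<^sup>2) / (2 * y * \<sigma>) \<le> ((r + K * b) * (r * b + K) + (1 + b)\<^sup>2) / 2" .
  moreover have "0 \<le> ((norm (x - z))\<^sup>2 + (y - \<sigma>)\<^sup>2) / (2 * y * \<sigma>)" using y \<sigma> by simp
  ultimately show ?thesis
    unfolding hrho_def fst_conv snd_conv by (intro arcosh_real_mono) auto
qed

lemma Lambda_diffk_le:
  fixes f :: "real^'n \<Rightarrow> real"
  assumes "f \<in> Lambda s"
  shows "\<exists>A. \<forall>x h. norm h \<le> 1 \<longrightarrow> \<bar>diffk (nat \<lfloor>s\<rfloor> + 1) h f x\<bar> \<le> A * norm h powr s"
proof -
  let ?N = "nat \<lfloor>s\<rfloor> + 1"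
  obtain C F where C: "\<And>x y. y \<in> {0<..1} \<Longrightarrow> DeltaR ?N f x y / y powr s \<le> C"
    and F: "\<And>x. \<bar>f x\<bar> \<le> F"
    using assms unfolding Lambda_def bounded_iff real_norm_def by blast
  have "\<bar>diffk ?N h f x\<bar> \<le> C * norm h powr s" if h: "norm h \<le> 1" for x h
  proof (cases "h = 0")
    \<comment> \<open>Step length 0 is outside the range of y in \<open>Lambda\<close>; both sides
      vanish, since the order is positive and 0 powr s = 0.\<close>
    case True
    then show ?thesis by (simp add: diffk_Suc_commute del: diffk.simps)
  next
    case False
    have "\<bar>diffk ?N h f x\<bar> \<le> DeltaR ?N f x (norm h)"
      unfolding DeltaR_def
    proof (rule cSUP_upper)
      \<comment> \<open>Boundedness of f makes the real supremum in \<open>DeltaR\<close> a genuine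
        upper bound.\<close>
      show "bdd_above ((\<lambda>h. \<bar>diffk ?N h f x\<bar>) ` {h'. norm h' = norm h})"
        by (rule bdd_aboveI2) (rule abs_diffk_le[OF F])
    qed simp
    also have "\<dots> \<le> C * norm h powr s"
      using C[of "norm h" x] h False by (simp add: field_simps)
    finally show ?thesis .
  qed
  then show ?thesis by blast
qed

section \<open>Differences of pieces and decay of the coefficients of f\<close>

context wavelet_basis
begin

lemma diffk_wav:
  "diffk r h (wav \<Psi> (l, i, k)) x
     = 2 powr (real i * real CARD('n) / 2) * diffk r ((2 ^ i) *\<^sub>R h) (\<Psi> l) ((2 ^ i) *\<^sub>R x - intvec k)"
proof -
  have "(2 ^ i) *\<^sub>R (x + c *\<^sub>R h) - intvec k = (2 ^ i) *\<^sub>R x - intvec k + c *\<^sub>R ((2 ^ i) *\<^sub>R h)" for c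
    by (simp add: scaleR_add_right mult.commute)
  then show ?thesis
    unfolding diffk_eq_sum wav_def split_conv sum_distrib_left by (intro sum.cong refl) (simp only: mult_ac)
qed

text \<open>The coefficient bound is required only for wavelets near one of the r+1 sample points.
  In the theorem this locality is what absence of large coefficients in a hyperbolic ball can
  provide.\<close>

lemma abs_diffk_piece_le:
  assumes G: "\<And>l h x. l < 2 ^ CARD('n) \<Longrightarrow> \<bar>diffk r h (\<Psi> l) x\<bar> \<le> G * min 1 (norm h ^ p)"
    and c: "c \<ge> 0"
    and coefs: "\<And>l k q. l \<in> types i \<Longrightarrow> q \<le> r \<Longrightarrow> k \<in> near i (x + (real r / 2 - real q) *\<^sub>R h) \<Longrightarrow>
       \<bar>coef f (l, i, k)\<bar> \<le> c * 2 powr (- real i * (s + real CARD('n) / 2))"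
  shows "\<bar>diffk r h (piece f i) x\<bar>
     \<le> 2 ^ CARD('n) * (real (Suc r) * many) * (c * (G * min 1 ((2 ^ i * norm h) ^ p)) * (2 powr - s) ^ i)"
proof -
  define pt where "pt q = x + (real r / 2 - real q) *\<^sub>R h" for q
  define S where "S = (\<Union>q\<le>r. near i (pt q))"
  have fS: "finite S" unfolding S_def using finite_near by blast
  have "real (card S) \<le> real (\<Sum>q\<le>r. card (near i (pt q)))"
    unfolding S_def by (intro of_nat_mono card_UN_le) simp
  also have "\<dots> \<le> (\<Sum>q\<le>r. many)"
    unfolding of_nat_sum by (intro sum_mono card_near)
  finally have cS: "real (card S) \<le> real (Suc r) * many" by simp
  have "diffk r h (piece f i) x
      = (\<Sum>q\<le>r. (-1)^q * real (r choose q) * (\<Sum>l\<in>types i. \<Sum>k\<in>S. coef f (l, i, k) * wav \<Psi> (l, i, k) (pt q)))"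
    unfolding diffk_eq_sum pt_def[symmetric]
    by (intro sum.cong refl arg_cong2[where f="(*)"] piece_eq fS) (auto simp: S_def)
  also have "\<dots> = diffk r h (\<lambda>x. \<Sum>lk\<in>types i \<times> S. coef f (fst lk, i, snd lk) * wav \<Psi> (fst lk, i, snd lk) x) x"
    unfolding diffk_eq_sum pt_def[symmetric] by (simp add: sum.cartesian_product case_prod_unfold)
  also have "\<dots> = (\<Sum>l\<in>types i. \<Sum>k\<in>S. coef f (l, i, k) * diffk r h (wav \<Psi> (l, i, k)) x)"
    unfolding diffk_sum by (simp add: sum.cartesian_product case_prod_unfold)
  finally have e: "diffk r h (piece f i) x
      = (\<Sum>l\<in>types i. \<Sum>k\<in>S. coef f (l, i, k) * diffk r h (wav \<Psi> (l, i, k)) x)" .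
  have G0: "G \<ge> 0" using G[of 0 "axis undefined 1" 0] by (simp add: norm_axis_1 order_trans[OF abs_ge_zero])
  show ?thesis unfolding e
  proof (rule abs_double_sum_le[OF _ cS])
    fix l k assume l: "l \<in> types i" and "k \<in> S"
    then obtain q where q: "q \<le> r" "k \<in> near i (pt q)" by (auto simp: S_def)
    show "\<bar>coef f (l, i, k) * diffk r h (wav \<Psi> (l, i, k)) x\<bar>
        \<le> c * (G * min 1 ((2 ^ i * norm h) ^ p)) * (2 powr - s) ^ i"
    proof (rule decay_term_le)
      show "\<bar>coef f (l, i, k)\<bar> \<le> c * 2 powr (- real i * (s + real CARD('n) / 2))"
        using coefs[OF l q(1)] q(2) by (simp add: pt_def)
      have "\<bar>diffk r ((2 ^ i) *\<^sub>R h) (\<Psi> l) ((2 ^ i) *\<^sub>R x - intvec k)\<bar> \<le> G * min 1 (norm ((2 ^ i) *\<^sub>R h) ^ p)"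
        using G typesD[OF l] by blast
      then show "\<bar>diffk r h (wav \<Psi> (l, i, k)) x\<bar>
          \<le> 2 powr (real i * real CARD('n) / 2) * (G * min 1 ((2 ^ i * norm h) ^ p))"
        unfolding diffk_wav by (simp add: abs_mult)
    qed
  qed (use c G0 in auto)
qed

lemma diffk_sums:
  assumes "decay C s f" "s > 0" "continuous_on UNIV f" "\<And>x. \<bar>f x\<bar> \<le> B"
  shows "(\<lambda>i. diffk r h (piece f i) x) sums diffk r h f x"
  unfolding diffk_eq_sum by (intro sums_sum sums_mult wavelet_expansion[OF assms])

text \<open>The normalised scaling function serves as the mollifier. With N = floor(s)+1, the
  integer L > s satisfies L >= N, so the smoothness and the moments needed for order N are
  available.\<close>

lemma holder_decay:
  assumes f: "f \<in> Lambda s" and s: "s > 0" "real L > s"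
    and \<phi>: "Ck L (\<Psi> 0)"
    and mom: "\<And>l \<alpha>::'n \<Rightarrow> nat. 1 \<le> l \<Longrightarrow> l < 2 ^ CARD('n) \<Longrightarrow> sum \<alpha> UNIV \<le> L \<Longrightarrow>
      (LINT x|lborel. monomial \<alpha> x * \<Psi> l x) = 0"
  shows "\<exists>C. decay C s f"
proof -
  define N where "N = nat \<lfloor>s\<rfloor> + 1"
  have N: "s < real N" "N \<le> L"
    using s by (auto simp: N_def) linarith+
  have cf: "continuous_on UNIV f" using f by (simp add: Lambda_def)
  obtain F where F: "\<And>x. \<bar>f x\<bar> \<le> F" using f unfolding Lambda_def bounded_iff real_norm_def by blast
  obtain A where A: "\<And>x h. norm h \<le> 1 \<Longrightarrow> \<bar>diffk N h f x\<bar> \<le> A * norm h powr s"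
    using Lambda_diffk_le[OF f] unfolding N_def by blast
  define I where "I = (LINT x|lborel. \<Psi> 0 x)"
  have I: "I \<noteq> 0" using scaling_function_mean by (simp add: I_def)
  have z: "(0::nat) < 2 ^ CARD('n)" by simp
  have "bounded {x. \<Psi> 0 x \<noteq> 0}"
    by (rule bounded_subset[OF bounded_cball[of 0 K]]) (use supp[OF z] in force)
  then obtain T where T: "\<And>a. \<exists>p. poly_lt N p \<and> (\<forall>z. \<bar>\<Psi> 0 (a + z) - p z\<bar> \<le> T * norm z ^ N)"
    using Ck_taylor[OF Ck_le[OF \<phi> N(2)]] by blast
  interpret mol: mollifier "\<lambda>x. \<Psi> 0 x / I" K "T / \<bar>I\<bar>" "M / \<bar>I\<bar>" N
  proof
    show "continuous_on UNIV (\<lambda>x. \<Psi> 0 x / I)" using cont[OF z] I by (intro continuous_intros) auto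
    show "\<bar>\<Psi> 0 x / I\<bar> \<le> M / \<bar>I\<bar>" for x using M[OF z] by (simp add: divide_right_mono)
    show "(LINT x|lborel. \<Psi> 0 x / I) = 1" using I by (simp add: I_def)
    show "\<exists>p. poly_lt N p \<and> (\<forall>z. \<bar>\<Psi> 0 (a + z) / I - p z\<bar> \<le> T / \<bar>I\<bar> * norm z ^ N)" for a
    proof -
      obtain p where p: "poly_lt N p" "\<And>z. \<bar>\<Psi> 0 (a + z) - p z\<bar> \<le> T * norm z ^ N" using T by blast
      have "\<bar>\<Psi> 0 (a + z) / I - 1 / I * p z\<bar> \<le> T / \<bar>I\<bar> * norm z ^ N" for z
        using divide_right_mono[OF p(2)[of z], of "\<bar>I\<bar>"] by (simp add: diff_divide_distrib[symmetric])
      then show ?thesis using poly_lt.scale[OF p(1), of "1 / I"] by blast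
    qed
  qed (use supp[OF z] K in auto)
  obtain C where C0: "C \<ge> 0" and C: "\<And>a \<delta> H \<theta>. \<delta> > 0 \<Longrightarrow> test_fun N a \<delta> H \<theta> \<Longrightarrow>
      \<bar>LINT x|lborel. f x * \<theta> x\<bar> \<le> C * H * (\<delta> ^ CARD('n) * \<delta> powr s)"
    using mol.vanishing_moments_decay[OF cf F s(1) N(1) A] by blast
  have fine: "\<bar>coef f (l, i, k)\<bar> \<le> C * M * (K ^ CARD('n) * K powr s) * 2 powr (- real i * (s + real CARD('n) / 2))"
    if l: "1 \<le> l" "l < 2 ^ CARD('n)" for l i k
  proof -
    \<comment> \<open>The wavelet without 2^(i n/2), a test function of height M and radius K/2^i;
      its bound (K/2^i)^(n+s) times 2^(i n/2) is the required decay.\<close>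
    define \<theta> where "\<theta> x = \<Psi> l ((2 ^ i) *\<^sub>R x - intvec k)" for x
    have w: "wav \<Psi> (l, i, k) x = 2 powr (real i * real CARD('n) / 2) * \<theta> x" for x
      by (simp add: wav_def \<theta>_def)
    have c\<theta>: "continuous_on UNIV \<theta>"
      unfolding \<theta>_def by (intro continuous_intros continuous_on_compose2[OF cont[OF l(2)]]) auto
    have "test_fun N (center i k) (K / 2 ^ i) M \<theta>"
      unfolding test_fun_def
    proof (intro conjI allI impI)
      show "\<theta> \<in> borel_measurable borel" using c\<theta> by (rule borel_measurable_continuous_onI)
      show "\<bar>\<theta> x\<bar> \<le> M" for x using M[OF l(2)] by (simp add: \<theta>_def)
      show "\<theta> x = 0" if "x \<notin> cball (center i k) (K / 2 ^ i)" for x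
        using wav_outside_cball[OF l(2) that] by (simp add: w)
      fix p :: "real^'n \<Rightarrow> real" assume p: "poly_lt N p"
      have m: "(\<lambda>x. p x * \<theta> x) \<in> borel_measurable borel"
        by (intro borel_measurable_continuous_onI continuous_intros c\<theta> poly_lt_continuous[OF p])
      have "(LINT x|lborel. p x * \<theta> x) = (1 / 2 ^ i) ^ CARD('n) *
          (LINT x|lborel. p (center i k + (1 / 2 ^ i) *\<^sub>R x) * \<theta> (center i k + (1 / 2 ^ i) *\<^sub>R x))"
        using lborel_integral_affine[OF m, of "1 / 2 ^ i" "center i k"] by simp
      also have "(\<lambda>x. \<theta> (center i k + (1 / 2 ^ i) *\<^sub>R x)) = \<Psi> l"
        by (simp add: \<theta>_def center_def scaleR_add_right fun_eq_iff)
      then have "(\<lambda>x. p (center i k + (1 / 2 ^ i) *\<^sub>R x) * \<theta> (center i k + (1 / 2 ^ i) *\<^sub>R x))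
          = (\<lambda>x. p (center i k + (1 / 2 ^ i) *\<^sub>R x) * \<Psi> l x)" by metis
      also have "(LINT x|lborel. p (center i k + (1 / 2 ^ i) *\<^sub>R x) * \<Psi> l x) = 0"
        by (rule poly_lt_moment_zero[OF cont[OF l(2)] supp[OF l(2)] mom[OF l] poly_lt_affine[OF p]])
           (use N in auto)
      finally show "(LINT x|lborel. p x * \<theta> x) = 0" by simp
    qed
    then have "\<bar>LINT x|lborel. f x * \<theta> x\<bar> \<le> C * M * ((K / 2 ^ i) ^ CARD('n) * (K / 2 ^ i) powr s)"
      using K by (intro C) auto
    moreover have "coef f (l, i, k) = 2 powr (real i * real CARD('n) / 2) * (LINT x|lborel. f x * \<theta> x)"
      unfolding coef_def w integral_mult_right_zero[symmetric] by (simp only: mult.left_commute)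
    ultimately have "\<bar>coef f (l, i, k)\<bar> \<le> 2 powr (real i * real CARD('n) / 2) *
        (C * M * ((K / 2 ^ i) ^ CARD('n) * (K / 2 ^ i) powr s))"
      by (simp add: abs_mult)
    also have "\<dots> = C * M * (K ^ CARD('n) * K powr s) * (2 powr (real i * real CARD('n) / 2) *
        (2 powr (- real i * real CARD('n)) * 2 powr (- real i * s)))"
    proof -
      have "K / 2 ^ i = K * 2 powr (- real i)" by (simp add: powr_minus powr_realpow divide_inverse)
      moreover have "(2 powr (- real i)) ^ CARD('n) = 2 powr (- real i * real CARD('n))"
        by (simp add: powr_realpow[symmetric] powr_powr)
      moreover have "(2 powr (- real i)) powr s = 2 powr (- real i * s)" by (simp add: powr_powr)
      ultimately show ?thesis using K by (simp add: power_mult_distrib powr_mult)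
    qed
    also have "2 powr (real i * real CARD('n) / 2) * (2 powr (- real i * real CARD('n)) * 2 powr (- real i * s))
        = 2 powr (- real i * (s + real CARD('n) / 2))"
    proof -
      have "real i * real CARD('n) / 2 + (- real i * real CARD('n) + - real i * s) = - real i * (s + real CARD('n) / 2)"
        by (simp add: algebra_simps)
      then show ?thesis by (simp only: powr_add[symmetric])
    qed
    finally show ?thesis .
  qed
  let ?C = "max (C * M * (K ^ CARD('n) * K powr s)) (F * M * (unit_ball_vol (real CARD('n)) * K ^ CARD('n)))"
  have "\<bar>coef f (l, i, k)\<bar> \<le> ?C * 2 powr (- real i * (s + real CARD('n) / 2))" if "l \<in> types i" for l i k
  proof (cases "l = 0")
    case True
    then have "i = 0" using that by (simp add: types_def)
    then show ?thesis using abs_coef_coarse_le[of l f F k] F typesD[OF that] by simp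
  next
    case False
    then have "\<bar>coef f (l, i, k)\<bar> \<le> C * M * (K ^ CARD('n) * K powr s) * 2 powr (- real i * (s + real CARD('n) / 2))"
      using typesD[OF that] by (intro fine) auto
    also have "\<dots> \<le> ?C * 2 powr (- real i * (s + real CARD('n) / 2))"
      by (intro mult_right_mono) auto
    finally show ?thesis .
  qed
  then show ?thesis unfolding decay_def Omega_iff by blast
qed

end

text \<open>There are only finitely many generating functions, so they share one support radius and
  one bound.\<close>

lemma wavelet_system_basis:
  fixes \<phi> :: "real^'n \<Rightarrow> real"
  assumes W: "wavelet_system L \<phi> \<psi>"
  defines "\<Psi> \<equiv> \<lambda>l. if l = 0 then \<phi> else \<psi> l"
  obtains K M where "wavelet_basis \<Psi> K M" and "\<And>l. l < 2 ^ CARD('n) \<Longrightarrow> Ck L (\<Psi> l)"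
    and "\<And>l. l < 2 ^ CARD('n) \<Longrightarrow> bounded {x. \<Psi> l x \<noteq> 0}"
    and "\<And>w. w \<in> Omega \<Longrightarrow> wav \<Psi> w = psiw \<phi> \<psi> w"
proof -
  have C: "Ckc L (\<Psi> l)" if "l < 2 ^ CARD('n)" for l
  proof (cases "l = 0")
    case False
    then have "l \<in> {1..2 ^ CARD('n) - 1}" using that by auto
    then show ?thesis using W False by (simp add: wavelet_system_def \<Psi>_def)
  qed (use W in \<open>simp add: wavelet_system_def \<Psi>_def\<close>)
  have Ck: "Ck L (\<Psi> l)" if "l < 2 ^ CARD('n)" for l using C[OF that] by (simp add: Ckc_def)
  have co: "continuous_on UNIV (\<Psi> l)" if "l < 2 ^ CARD('n)" for l
    using Ck_le[OF Ck[OF that], of 0] by simp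
  have bs: "bounded {x. \<Psi> l x \<noteq> 0}" if "l < 2 ^ CARD('n)" for l
    using C[OF that] closure_subset[of "{x. \<Psi> l x \<noteq> 0}"] unfolding Ckc_def
    by (meson bounded_subset compact_imp_bounded)
  have w: "wav \<Psi> w = psiw \<phi> \<psi> w" if "w \<in> Omega" for w
    using that by (auto simp: wav_def psiw_def Omega_def \<Psi>_def fun_eq_iff)
  have "bounded (\<Union>l<2 ^ CARD('n). {x. \<Psi> l x \<noteq> 0})"
    using bs by (intro bounded_UN) auto
  then obtain K where K: "\<And>l x. l < 2 ^ CARD('n) \<Longrightarrow> \<Psi> l x \<noteq> 0 \<Longrightarrow> norm x \<le> K"
    unfolding bounded_iff by auto
  have "\<forall>l. \<exists>M. l < 2 ^ CARD('n) \<longrightarrow> (\<forall>x. \<bar>\<Psi> l x\<bar> \<le> M)"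
    using continuous_bounded_support_bounded[OF co bs] by blast
  then obtain m where m: "\<And>l x. l < 2 ^ CARD('n) \<Longrightarrow> \<bar>\<Psi> l x\<bar> \<le> m l" by metis
  have M: "\<bar>\<Psi> l x\<bar> \<le> Max (m ` {..<2 ^ CARD('n)})" if "l < 2 ^ CARD('n)" for l x
    by (rule order_trans[OF m[OF that] Max_ge]) (use that in auto)
  have "wavelet_basis \<Psi> (max 1 K) (Max (m ` {..<2 ^ CARD('n)}))"
  proof
    show "(LINT x|lborel. \<Psi> l x) = 0" if l: "1 \<le> l" "l < 2 ^ CARD('n)" for l
    proof -
      have "l \<in> {1..2 ^ CARD('n) - 1}" using l by auto
      then have "(LINT x|lborel. monomial (\<lambda>_::'n. 0) x * \<psi> l x) = 0"
        using W unfolding wavelet_system_def by fastforce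
      then show ?thesis using l by (simp add: monomial_0 \<Psi>_def)
    qed
    show "(LINT x|lborel. wav \<Psi> w x * wav \<Psi> w' x) = (if w = w' then 1 else 0)"
      if "w \<in> Omega" "w' \<in> Omega" for w w'
      using W that by (simp add: w wavelet_system_def)
    show "AE x in lborel. g x = 0"
      if "g \<in> borel_measurable lborel" "integrable lborel (\<lambda>x. (g x)\<^sup>2)"
        "\<And>w. w \<in> Omega \<Longrightarrow> (LINT x|lborel. g x * wav \<Psi> w x) = 0" for g
    proof -
      have "\<forall>g. g \<in> borel_measurable lborel \<and> integrable lborel (\<lambda>x. (g x)\<^sup>2) \<and>
          (\<forall>w\<in>Omega. (LINT x|lborel. g x * psiw \<phi> \<psi> w x) = 0) \<longrightarrow> (AE x in lborel. g x = 0)"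
        using W unfolding wavelet_system_def by blast
      moreover have "\<forall>w\<in>Omega. (LINT x|lborel. g x * psiw \<phi> \<psi> w x) = 0"
        using that(3) by (simp add: w[symmetric])
      ultimately show ?thesis using that(1,2) by blast
    qed
    show "\<Psi> l x = 0" if "l < 2 ^ CARD('n)" "norm x > max 1 K" for l x
      using K[OF that(1), of x] that(2) by fastforce
  qed (use co M in auto)
  then show thesis using that Ck bs w by blast
qed

text \<open>Short steps use p derivatives and pay 2^(r-p) for the other differences; long steps use
  only the boundedness of g.\<close>

lemma diffk_bound_min:
  fixes g :: "real^'n \<Rightarrow> real"
  assumes "Ck p g" "bounded {x. g x \<noteq> 0}" "p \<le> r"
  shows "\<exists>G\<ge>0. \<forall>h x. \<bar>diffk r h g x\<bar> \<le> G * min 1 (norm h ^ p)"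
proof -
  obtain B where B: "\<And>x. \<bar>g x\<bar> \<le> B" "B \<ge> 0"
    using continuous_bounded_support_bounded[of g] Ck_le[OF assms(1), of 0] assms(2) by auto
  obtain C where C: "C \<ge> 0" "\<And>h x. \<bar>diffk p h g x\<bar> \<le> C * norm h ^ p"
    using diffk_bound_Ck[OF assms(1,2)] by blast
  let ?G = "max (2 ^ r * B) (2 ^ (r - p) * C)"
  have "\<bar>diffk r h g x\<bar> \<le> ?G * min 1 (norm h ^ p)" for h x
  proof (cases "norm h ^ p \<le> 1")
    case True
    have "\<bar>diffk (p + (r - p)) h g x\<bar> \<le> 2 ^ (r - p) * (C * norm h ^ p)"
      by (rule abs_diffk_add_le) (rule C(2))
    also have "\<dots> = (2 ^ (r - p) * C) * norm h ^ p" by simp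
    also have "\<dots> \<le> ?G * norm h ^ p" by (intro mult_right_mono) auto
    finally show ?thesis using True assms(3) by (simp add: min_def)
  next
    case False
    have "\<bar>diffk r h g x\<bar> \<le> ?G" using abs_diffk_le[of g B r h x, OF B(1)] by linarith
    then show ?thesis using False by (simp add: min_def)
  qed
  moreover have "?G \<ge> 0" using B(2) by (simp add: le_max_iff_disj)
  ultimately show ?thesis by blast
qed

section \<open>Large differences near large wavelet coefficients\<close>

lemma powr_dyadic_le: "\<bar>int i - int j\<bar> \<le> int m \<Longrightarrow> 2 powr - real j \<le> 2 ^ m * 2 powr - real i"
proof -
  assume "\<bar>int i - int j\<bar> \<le> int m"
  then have "real i \<le> real m + real j" by linarith
  then have "2 powr - real j \<le> 2 powr (real m + - real i)" by (intro powr_mono) auto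
  then show ?thesis unfolding powr_add by (simp add: powr_realpow)
qed

theorem mainTheorem10:
  fixes s :: real and r L :: nat
    and \<phi> :: "real^'n \<Rightarrow> real" and \<psi> :: "nat \<Rightarrow> real^'n \<Rightarrow> real"
  assumes "s > 0" and "real r > s"
    and "wavelet_system L \<phi> \<psi>"
    and "L + 1 \<ge> r" and "real L > s"
  shows "\<exists>c\<in>{0<..<1::real}. \<forall>\<epsilon>>0. \<forall>f\<in>Lambda s.
           \<exists>(m::nat) (R::real). R > 1 \<and>
             (\<forall>j::nat. S_set r j s f \<epsilon> \<subseteq>
                (\<Union>i\<in>{int j - int m .. int j + int m}. hnbhd (T0 \<phi> \<psi> i s f (c * \<epsilon>)) R))"
proof -
  define \<Psi> where "\<Psi> = (\<lambda>l. if l = 0 then \<phi> else \<psi> l)"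
  obtain K M where "wavelet_basis \<Psi> K M" and CkL: "\<And>l. l < 2 ^ CARD('n) \<Longrightarrow> Ck L (\<Psi> l)"
    and bs: "\<And>l. l < 2 ^ CARD('n) \<Longrightarrow> bounded {x. \<Psi> l x \<noteq> 0}"
    and wav: "\<And>w. w \<in> Omega \<Longrightarrow> wav \<Psi> w = psiw \<phi> \<psi> w"
    unfolding \<Psi>_def by (rule wavelet_system_basis[OF assms(3)]) blast
  interpret wavelet_basis \<Psi> K M by fact
  \<comment> \<open>The gain at coarse scales is limited both by the order of the difference and by
    the smoothness of the wavelets.\<close>
  define p where "p = min r L"
  have p: "real p > s" using assms by (simp add: p_def min_def)
  have "\<forall>l. \<exists>G. l < 2 ^ CARD('n) \<longrightarrow> (\<forall>h x. \<bar>diffk r h (\<Psi> l) x\<bar> \<le> G * min 1 (norm h ^ p))"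
  proof
    fix l
    show "\<exists>G. l < 2 ^ CARD('n) \<longrightarrow> (\<forall>h x. \<bar>diffk r h (\<Psi> l) x\<bar> \<le> G * min 1 (norm h ^ p))"
    proof (cases "l < 2 ^ CARD('n)")
      case True
      have "Ck p (\<Psi> l)" by (rule Ck_le[OF CkL[OF True]]) (simp add: p_def)
      from diffk_bound_min[OF this bs[OF True], of r] show ?thesis by (auto simp: p_def)
    qed simp
  qed
  then obtain g where g: "\<And>l h x. l < 2 ^ CARD('n) \<Longrightarrow> \<bar>diffk r h (\<Psi> l) x\<bar> \<le> g l * min 1 (norm h ^ p)"
    by metis
  define G where "G = max 0 (Max (g ` {..<2 ^ CARD('n)}))"
  have G0: "G \<ge> 0" by (simp add: G_def)
  have G: "\<bar>diffk r h (\<Psi> l) x\<bar> \<le> G * min 1 (norm h ^ p)" if l: "l < 2 ^ CARD('n)" for l h x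
  proof -
    have "g l \<le> G" unfolding G_def using l by (intro max.coboundedI2 Max_ge) auto
    then have "g l * min 1 (norm h ^ p) \<le> G * min 1 (norm h ^ p)" by (intro mult_right_mono) auto
    with g[OF l, of h x] show ?thesis by linarith
  qed
  \<comment> \<open>The slower of the two decay rates in \<open>scale_balance\<close>: s towards
    fine scales, p - s towards coarse ones.\<close>
  define \<tau> where "\<tau> = min s (real p - s)"
  have \<tau>: "\<tau> > 0" "\<tau> \<le> s" "\<tau> \<le> real p - s" using p assms(1) by (auto simp: \<tau>_def)
  define \<gamma> :: real where "\<gamma> = 2 powr - (\<tau> / 2)"
  have \<gamma>: "0 < \<gamma>" "\<gamma> < 1" using geometric_lt_1[of "\<tau> / 2"] \<tau> by (auto simp: \<gamma>_def)
  have \<gamma>2: "2 powr - \<tau> = \<gamma> * \<gamma>" by (simp add: \<gamma>_def powr_add[symmetric])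
  define E where "E = 2 ^ CARD('n) * (real (Suc r) * many) * G"
  have E: "E \<ge> 0" using G0 many_nonneg by (simp add: E_def)
  define Z where "Z = E * (2 / (1 - \<gamma>))"
  have Z: "Z \<ge> 0" using E \<gamma> by (simp add: Z_def)
  \<comment> \<open>Since y > 2^(-j-1), passing from 2^(-js) to y^s costs 2^(-s). Half of \<epsilon>
    2^(-s) is reserved for the terms with c and half for those with \<gamma>^m; the minimum with 1/2
    keeps c below 1.\<close>
  define c where "c = min (1/2) (2 powr - s / (2 * (Z + 1)))"
  have c: "0 < c" "c < 1" using Z by (auto simp: c_def)
  have Zc: "Z * c \<le> 2 powr - s / 2"
  proof -
    have "Z * c \<le> (Z + 1) * (2 powr - s / (2 * (Z + 1)))"
      using Z c by (intro mult_mono) (auto simp: c_def)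
    also have "\<dots> = 2 powr - s / 2"
      using Z by (simp add: divide_simps)
    finally show ?thesis .
  qed
  show ?thesis
  proof (intro bexI[of _ c] allI impI ballI)
    fix \<epsilon> :: real and f :: "real^'n \<Rightarrow> real"
    assume \<epsilon>: "\<epsilon> > 0" and f: "f \<in> Lambda s"
    have cf: "continuous_on UNIV f" using f by (simp add: Lambda_def)
    obtain F where F: "\<And>x. \<bar>f x\<bar> \<le> F" using f unfolding Lambda_def bounded_iff real_norm_def by blast
    obtain C where C: "decay C s f"
    proof -
      have "(LINT x|lborel. monomial \<alpha> x * \<Psi> l x) = 0"
        if "1 \<le> l" "l < 2 ^ CARD('n)" "sum \<alpha> UNIV \<le> L" for l \<alpha>
      proof -
        have "l \<in> {1..2 ^ CARD('n) - 1}" using that by auto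
        then show ?thesis using assms(3) that by (auto simp: wavelet_system_def \<Psi>_def)
      qed
      then show thesis using holder_decay[OF f assms(1,5) CkL] that by fastforce
    qed
    have C0: "C \<ge> 0" using decay_nonneg[OF C] .
    \<comment> \<open>The power \<gamma>^m must compensate for the decay constant C of f; the
      summand 1 keeps the denominator positive when Z C = 0.\<close>
    obtain m where m: "\<gamma> ^ m < \<epsilon> * 2 powr - s / (2 * (Z * C + 1))"
    proof -
      have "0 < \<epsilon> * 2 powr - s / (2 * (Z * C + 1))"
        using \<epsilon> Z C0 by (intro divide_pos_pos mult_pos_pos add_nonneg_pos) auto
      from real_arch_pow_inv[OF this \<gamma>(2)] show thesis using that by blast
    qed
    have ZC: "Z * C * \<gamma> ^ m \<le> \<epsilon> * 2 powr - s / 2"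
    proof -
      have ZC0: "0 \<le> Z * C" using Z C0 by simp
      have "Z * C * \<gamma> ^ m \<le> (Z * C + 1) * (\<epsilon> * 2 powr - s / (2 * (Z * C + 1)))"
        using ZC0 m \<gamma> by (intro mult_mono) auto
      also have "\<dots> = \<epsilon> * 2 powr - s / 2"
        using ZC0 by (simp add: add_nonneg_eq_0_iff field_simps)
      finally show ?thesis .
    qed
    \<comment> \<open>At most m dyadic steps separate i from j, and one more accounts for y ranging
      over (2^(-j-1), 2^(-j)].\<close>
    define b :: real where "b = 2 ^ Suc m"
    \<comment> \<open>The bound of \<open>hrho_le\<close>, plus 2 to make the distance estimate
      strict and R larger than 1.\<close>
    define R where "R = arcosh (1 + ((real r + K * b) * (real r * b + K) + (1 + b)\<^sup>2) / 2) + 2"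
    have b0: "b \<ge> 0" by (simp add: b_def)
    have R1: "R > 1"
    proof -
      have "0 \<le> (real r + K * b) * (real r * b + K) + (1 + b)\<^sup>2" using K b0 by simp
      then have "0 \<le> arcosh (1 + ((real r + K * b) * (real r * b + K) + (1 + b)\<^sup>2) / 2)"
        by (intro arcosh_nonneg_real) simp
      then show ?thesis by (simp add: R_def)
    qed
    show "\<exists>(m::nat) (R::real). R > 1 \<and> (\<forall>j::nat. S_set r j s f \<epsilon> \<subseteq>
        (\<Union>i\<in>{int j - int m .. int j + int m}. hnbhd (T0 \<phi> \<psi> i s f (c * \<epsilon>)) R))"
    proof (rule exI[of _ m], rule exI[of _ R], intro conjI R1 allI subsetI)
      fix j z assume z: "z \<in> S_set r j s f \<epsilon>"
      obtain x y where zxy: "z = (x, y)" by (cases z)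
      have y: "y > 0" and big: "DeltaR r f x y / y powr s > \<epsilon>"
        and yj: "2 powr (- real j - 1) < y" "y \<le> 2 powr - real j"
        using z by (auto simp: S_set_def zxy)
      show "z \<in> (\<Union>i\<in>{int j - int m .. int j + int m}. hnbhd (T0 \<phi> \<psi> i s f (c * \<epsilon>)) R)"
      proof (rule ccontr)
        assume far: "z \<notin> (\<Union>i\<in>{int j - int m .. int j + int m}. hnbhd (T0 \<phi> \<psi> i s f (c * \<epsilon>)) R)"
        \<comment> \<open>If a wavelet seen by the difference had a larger coefficient, its box
          would lie within hyperbolic distance R of z.\<close>
        have small: "\<bar>coef f (l, i, k)\<bar> \<le> c * \<epsilon> * 2 powr (- real i * (s + real CARD('n) / 2))"
          if l: "l \<in> types i" and im: "\<bar>int i - int j\<bar> \<le> int m" and q: "q \<le> r" and h: "norm h = y"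
            and k: "k \<in> near i (x + (real r / 2 - real q) *\<^sub>R h)" for l i k q h
        proof (rule ccontr)
          assume "\<not> ?thesis"
          moreover have "(2 powr (- real i * real CARD('n))) powr (s / real CARD('n) + 1/2)
              = 2 powr (- real i * (s + real CARD('n) / 2))"
            by (simp add: powr_powr algebra_simps)
          moreover have w: "(l, i, k) \<in> Omega" using l by (simp add: Omega_iff)
          ultimately have "k \<in> W0 \<phi> \<psi> i s f (c * \<epsilon>)"
            unfolding W0_def by (auto simp: coef_def wav[OF w] not_le intro!: exI[of _ l])
          \<comment> \<open>The lower corner belongs to the half-open cube, and its side length is
            the included upper end of the range of heights.\<close>
          moreover have "(center i k, 2 powr - real i) \<in> Tbox i k"
            by (simp add: Tbox_def dcube_def center_def intvec_nth powr_minus powr_realpow field_simps)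
          ultimately have T: "(center i k, 2 powr - real i) \<in> T0 \<phi> \<psi> (int i) s f (c * \<epsilon>)"
            by (auto simp: T0_def)
          have "hrho (x, y) (center i k, 2 powr - real i) \<le> arcosh (1 + ((real r + K * b) * (real r * b + K) + (1 + b)\<^sup>2) / 2)"
          proof (rule hrho_le[OF y])
            have "y \<le> 2 ^ m * 2 powr - real i" using yj(2) powr_dyadic_le[OF im] by linarith
            also have "\<dots> \<le> b * 2 powr - real i" by (simp add: b_def)
            finally show "y \<le> b * 2 powr - real i" .
            have "2 powr - real i \<le> 2 ^ m * 2 powr - real j"
              using im by (intro powr_dyadic_le) (simp add: abs_minus_commute)
            also have "\<dots> = b * 2 powr (- real j - 1)"
              by (simp add: b_def powr_diff)
            also have "\<dots> \<le> b * y" using yj(1) b0 by (intro mult_left_mono) auto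
            finally show "2 powr - real i \<le> b * y" .
            have "norm (x + (real r / 2 - real q) *\<^sub>R h - center i k) \<le> K * 2 powr - real i"
            proof -
              have "K / 2 ^ i = K * 2 powr - real i" by (simp add: powr_minus powr_realpow divide_inverse)
              then show ?thesis
                using k unfolding near_iff mem_cball dist_norm by (simp only: norm_minus_commute)
            qed
            moreover have "norm ((real r / 2 - real q) *\<^sub>R h) \<le> real r * y"
            proof -
              have "\<bar>real r / 2 - real q\<bar> \<le> real r" using q by linarith
              then show ?thesis unfolding norm_scaleR h using y by (intro mult_right_mono) auto
            qed
            moreover have "norm (x - center i k) \<le> norm (x + (real r / 2 - real q) *\<^sub>R h - center i k)
                + norm ((real r / 2 - real q) *\<^sub>R h)"
              using norm_triangle_ineq4[of "x + (real r / 2 - real q) *\<^sub>R h - center i k" "(real r / 2 - real q) *\<^sub>R h"]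
              by simp
            ultimately show "norm (x - center i k) \<le> real r * y + K * 2 powr - real i" by linarith
          qed (use K in auto)
          then have "hrho z (center i k, 2 powr - real i) < R" by (simp add: R_def zxy)
          then have "z \<in> hnbhd (T0 \<phi> \<psi> (int i) s f (c * \<epsilon>)) R"
            using T y unfolding hnbhd_def by (auto simp: zxy)
          moreover have "int i \<in> {int j - int m .. int j + int m}" using im by auto
          ultimately show False using far by blast
        qed
        have bound: "\<bar>diffk r h f x\<bar> \<le> \<epsilon> * y powr s" if h: "norm h = y" for h
        proof -
          define Y where "Y = 2 powr (- real j * s)"
          \<comment> \<open>Half of the decay \<open>\<gamma>\<^sup>2\<close> is given up to make the scales beyond distance \<open>m\<close> small.\<close>
          define A where "A = c * \<epsilon> + C * \<gamma> ^ m"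
          have A: "A \<ge> 0" using c \<epsilon> C0 \<gamma> by (simp add: A_def)
          have le: "\<bar>diffk r h (piece f i) x\<bar> \<le> E * Y * A * \<gamma> ^ nat \<bar>int i - int j\<bar>" for i
          proof -
            define d where "d = nat \<bar>int i - int j\<bar>"
            \<comment> \<open>Near scale j the absence of large coefficients is used, elsewhere only
              the general decay of f.\<close>
            define ci where "ci = (if d \<le> m then c * \<epsilon> else C)"
            have ci: "ci \<ge> 0" using c \<epsilon> C0 by (simp add: ci_def)
            have "\<bar>diffk r h (piece f i) x\<bar>
                \<le> 2 ^ CARD('n) * (real (Suc r) * many) * (ci * (G * min 1 ((2 ^ i * norm h) ^ p)) * (2 powr - s) ^ i)"
            proof (rule abs_diffk_piece_le[OF G ci])
              fix l k q assume "l \<in> types i" "q \<le> r" "k \<in> near i (x + (real r / 2 - real q) *\<^sub>R h)"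
              then show "\<bar>coef f (l, i, k)\<bar> \<le> ci * 2 powr (- real i * (s + real CARD('n) / 2))"
                using small[of l i q h k] h C unfolding ci_def d_def decay_def by (auto simp: Omega_iff)
            qed
            also have "\<dots> = E * ci * ((2 powr - s) ^ i * min 1 ((2 ^ i * y) ^ p))"
              by (simp add: E_def h)
            also have "\<dots> \<le> E * ci * (Y * (2 powr - \<tau>) ^ d)"
              unfolding Y_def d_def using E ci y yj \<tau> by (intro mult_left_mono scale_balance) auto
            also have "\<dots> = E * Y * (ci * (\<gamma> ^ d * \<gamma> ^ d))"
              by (simp add: \<gamma>2 power_mult_distrib)
            also have "\<dots> \<le> E * Y * (A * \<gamma> ^ d)"
            proof (intro mult_left_mono)
              show "ci * (\<gamma> ^ d * \<gamma> ^ d) \<le> A * \<gamma> ^ d"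
              proof (cases "d \<le> m")
                case True
                have "ci * (\<gamma> ^ d * \<gamma> ^ d) \<le> ci * (1 * \<gamma> ^ d)"
                  using \<gamma> ci by (intro mult_left_mono mult_right_mono power_le_one) auto
                also have "\<dots> \<le> A * \<gamma> ^ d"
                  using True \<gamma> C0 by (simp add: A_def ci_def mult_right_mono)
                finally show ?thesis .
              next
                case False
                have "ci * (\<gamma> ^ d * \<gamma> ^ d) \<le> ci * (\<gamma> ^ m * \<gamma> ^ d)"
                  using \<gamma> ci False by (intro mult_left_mono mult_right_mono power_decreasing) auto
                also have "\<dots> \<le> A * \<gamma> ^ d"
                  using False \<gamma> c \<epsilon> by (simp add: A_def ci_def mult_right_mono mult.assoc[symmetric])
                finally show ?thesis .
              qed
            qed (use E in \<open>auto simp: Y_def\<close>)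
            finally show ?thesis by (simp add: d_def)
          qed
          have s1: "(\<lambda>i. diffk r h (piece f i) x) sums diffk r h f x"
            by (rule diffk_sums[OF C assms(1) cf F])
          have s2: "(\<lambda>i. E * Y * A * \<gamma> ^ nat \<bar>int i - int j\<bar>) sums
              (E * Y * A * (1 / (1 - \<gamma>) + (\<Sum>d<j. \<gamma> ^ Suc d)))"
            by (intro sums_mult two_sided_geometric_sums \<gamma>)
          have "diffk r h f x \<le> E * Y * A * (1 / (1 - \<gamma>) + (\<Sum>d<j. \<gamma> ^ Suc d))"
            by (rule sums_le[OF _ s1 s2]) (rule order_trans[OF abs_ge_self le])
          moreover have "- diffk r h f x \<le> E * Y * A * (1 / (1 - \<gamma>) + (\<Sum>d<j. \<gamma> ^ Suc d))"
            by (rule sums_le[OF _ sums_minus[OF s1] s2]) (rule order_trans[OF abs_ge_minus_self le])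
          ultimately have "\<bar>diffk r h f x\<bar> \<le> E * Y * A * (1 / (1 - \<gamma>) + (\<Sum>d<j. \<gamma> ^ Suc d))" by linarith
          also have "\<dots> \<le> E * Y * A * (2 / (1 - \<gamma>))"
            using E A by (intro mult_left_mono two_sided_geometric_le \<gamma>) (auto simp: Y_def)
          also have "\<dots> = Y * (Z * c * \<epsilon> + Z * C * \<gamma> ^ m)" by (simp add: Z_def A_def algebra_simps)
          also have "\<dots> \<le> Y * (2 powr - s / 2 * \<epsilon> + \<epsilon> * 2 powr - s / 2)"
            using Zc ZC \<epsilon> by (intro mult_left_mono add_mono mult_right_mono) (auto simp: Y_def)
          also have "\<dots> = \<epsilon> * (2 powr (- real j - 1)) powr s"
          proof -
            have "(- real j - 1) * s = - real j * s + - s" by (simp add: algebra_simps)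
            then have "(2 powr (- real j - 1)) powr s = Y * 2 powr - s"
              by (simp only: Y_def powr_powr powr_add)
            then show ?thesis by simp
          qed
          also have "\<dots> \<le> \<epsilon> * y powr s"
            using \<epsilon> yj assms(1) by (intro mult_left_mono powr_mono2) auto
          finally show ?thesis .
        qed
        have "DeltaR r f x y \<le> \<epsilon> * y powr s"
          unfolding DeltaR_def
        proof (rule cSUP_least)
          show "{h::real^'n. norm h = y} \<noteq> {}" using vector_choose_size[of y] y by auto
        qed (use bound in auto)
        then have "DeltaR r f x y / y powr s \<le> \<epsilon>" using y by (simp add: divide_le_eq)
        with big show False by simp
      qed
    qed
  qed (use c in auto)
qed

end
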